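(* Let $\mathbb{D}$ be a distributive category. Then the Kleisli category $\mathbb{D}_{\_\oplus\mathsf{1}}$ of the exception monad on $\mathbb{D}$ (with its distributive restriction category structure described in the context) has classical products, and therefore $\mathbb{D}_{\_\oplus\mathsf{1}}$ is a classical distributive restriction category, i.e. a distributive restriction category which is also a classical restriction category.
   Context: Composition is written in diagrammatic order: for $f:A\to B$ and $g:B\to C$, $fg:A\to C$ is first $f$, then $g$. **Restriction categories.** A restriction category is a category $\mathbb{X}$ with an operator assigning to each map $f:A\to B$ a map $\overline{f}:A\to A$ such that (whenever the expressions are well-typed) [R.1] $\overline{f}f=f$; [R.2] $\overline{f}\,\overline{g}=\overline{g}\,\overline{f}$; [R.3] $\overline{\overline{g}f}=\overline{g}\,\overline{f}$; [R.4] $f\overline{g}=\overline{fg}f$. A map $f:A\to B$ is total if $\overline{f}=1_A$. $\mathbb{X}$ has restriction zeroes if it has zero maps $0:A\to B$ for all $A,B$ (so $f0=0=0f$ for all $f$) and $\overline{0}=0$. **Distributive restriction categories.** A Cartesian restriction category is a restriction category with (a) a restriction terminal object: an object $\mathsf{1}$ such that for each $A$ there is a unique total map $t_A:A\to\mathsf{1}$, and $f t_B=\overline{f}t_A$ for every $f:A\to B$; and (b) binary restriction products: for all $A,B$ an object $A\times B$ with total maps $\pi_0:A\times B\to A$, $\pi_1:A\times B\to B$ such that for all $f:C\to A$, $g:C\to B$ there is a unique $\langle f,g\rangle:C\to A\times B$ with $\langle f,g\rangle\pi_0=\overline{g}f$ and $\langle f,g\rangle\pi_1=\overline{f}g$.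 A coCartesian restriction category is a restriction category with finite coproducts $\oplus$ (initial object $\mathsf{0}$ with unique maps $z_A:\mathsf{0}\to A$, injections $\iota_j$, copairing $[-,\dots,-]$) whose injections are all total. A distributive restriction category is a restriction category that is both Cartesian and coCartesian and such that the canonical maps $[1_A\times\iota_0,\,1_A\times\iota_1]:(A\times B)\oplus(A\times C)\to A\times(B\oplus C)$ and $\langle z_A,1_{\mathsf{0}}\rangle:\mathsf{0}\to A\times\mathsf{0}$ are isomorphisms, where $1_A\times h=\langle\pi_0,\pi_1h\rangle$. **Classical products.** A distributive restriction category has classical products if it has restriction zeroes and, for all objects $A,B$, the object $A\& B:=A\oplus B\oplus(A\times B)$ with the maps $p_0:=[1_A,0,\pi_0]:A\& B\to A$ and $p_1:=[0,1_B,\pi_1]:A\& B\to B$ is a (genuine categorical) product of $A$ and $B$. **Classical restriction categories.** For parallel $f,g:A\to B$ in a restriction category: $f\le g$ means $\overline{f}g=f$; $f\smile g$ (compatible) means $\overline{f}g=\overline{g}f$; if there are restriction zeroes, $f\perp g$ (disjoint) means $\overline{f}g=0$. The join of a finite family of pairwise compatible parallel maps $f_0,\dots,f_n:A\to B$ is their least upper bound $f_0\vee\dots\vee f_n$ with respect to $\le$. A join restriction category is a restriction category in which every finite (possibly empty) pairwise compatible family of parallel maps has a join and joins are preserved by precomposition: $h(f_0\vee\dots\vee f_n)=hf_0\vee\dots\vee hf_n$. (Such a category has restriction zeroes, given by empty joins.) A classical restriction category is a join restriction category in which for all parallel $f\le g$ there is a (necessarily unique) map $g\backslash f$ (the relative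 complement) with $g\backslash f\perp f$ and $g\backslash f\vee f=g$. **Exception monad.** A distributive category $\mathbb{D}$ is a category with finite products ($\times$, terminal object $\mathsf{1}$, unique maps $t_A:A\to\mathsf{1}$) and finite coproducts ($\oplus$, initial object $\mathsf{0}$) such that the canonical maps $(A\times B)\oplus(A\times C)\to A\times(B\oplus C)$ and $\mathsf{0}\to A\times\mathsf{0}$ are isomorphisms. Its exception monad is $A\mapsto A\oplus\mathsf{1}$ with unit $\iota_0:A\to A\oplus\mathsf{1}$ and multiplication $[\iota_0,\iota_1,\iota_1]:A\oplus\mathsf{1}\oplus\mathsf{1}\to A\oplus\mathsf{1}$. Its Kleisli category $\mathbb{D}_{\_\oplus\mathsf{1}}$ has the objects of $\mathbb{D}$; a map $A\to B$ in it is a map $A\to B\oplus\mathsf{1}$ in $\mathbb{D}$; the identity on $A$ is $\iota_0$, and the composite of $f:A\to B\oplus\mathsf{1}$ and $g:B\to C\oplus\mathsf{1}$ is $f[g,\iota_1]$. It is known that $\mathbb{D}_{\_\oplus\mathsf{1}}$ is a distributive restriction category with restriction zeroes, where: the restriction of the Kleisli map given by $f:A\to B\oplus\mathsf{1}$ is the Kleisli map $A\to A$ given by $A\xrightarrow{\langle 1_A,f\rangle}A\times(B\oplus\mathsf{1})\cong(A\times B)\oplus(A\times\mathsf{1})\xrightarrow{\pi_0\oplus\pi_1}A\oplus\mathsf{1}$; the restriction terminal object is $\mathsf{1}$, and the restriction product of $A$ and $B$ is $A\times B$ with projections given by $\pi_j\iota_0$; coproducts are those of $\mathbb{D}$, with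 injections given by the injections of $\mathbb{D}$ followed by the unit $\iota_0$, and copairing as in $\mathbb{D}$; the zero map $A\to B$ is given by $t_A\iota_1:A\to B\oplus\mathsf{1}$. *)

theory Defs
  imports Main
begin

text \<open>
  Composition is in diagrammatic order throughout: \<open>f \<cdot> g\<close> is first \<open>f\<close>, then \<open>g\<close>.
  The values of the operations on non-composable or otherwise ill-typed arguments are irrelevant.
\<close>

record ('o, 'm) cat =
  Obj  :: "'o set"
  Arr  :: "'m set"
  Dom  :: "'m \<Rightarrow> 'o"
  Cod  :: "'m \<Rightarrow> 'o"
  Idn  :: "'o \<Rightarrow> 'm"
  Comp :: "'m \<Rightarrow> 'm \<Rightarrow> 'm"  (infixl "\<cdot>\<index>" 70)

definition hom :: "('o, 'm, 'z) cat_scheme \<Rightarrow> 'o \<Rightarrow> 'o \<Rightarrow> 'm set" where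
  "hom C A B = {f \<in> Arr C. Dom C f = A \<and> Cod C f = B}"

locale category =
  fixes C :: "('o, 'm) cat" (structure)
  assumes Dom_Obj: "f \<in> Arr C \<Longrightarrow> Dom C f \<in> Obj C"
    and Cod_Obj: "f \<in> Arr C \<Longrightarrow> Cod C f \<in> Obj C"
    and Idn_hom: "A \<in> Obj C \<Longrightarrow> Idn C A \<in> hom C A A"
    and Comp_hom: "\<lbrakk>f \<in> hom C A B; g \<in> hom C B D\<rbrakk> \<Longrightarrow> f \<cdot> g \<in> hom C A D"
    and Idn_Comp: "f \<in> hom C A B \<Longrightarrow> Idn C A \<cdot> f = f"
    and Comp_Idn: "f \<in> hom C A B \<Longrightarrow> f \<cdot> Idn C B = f"
    and Comp_assoc:
      "\<lbrakk>f \<in> hom C A B; g \<in> hom C B D; h \<in> hom C D E\<rbrakk> \<Longrightarrow> (f \<cdot> g) \<cdot> h = f \<cdot> (g \<cdot> h)"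

definition is_inverse :: "('o, 'm) cat \<Rightarrow> 'm \<Rightarrow> 'm \<Rightarrow> bool" where
  "is_inverse C f g \<longleftrightarrow> f \<in> Arr C \<and> g \<in> hom C (Cod C f) (Dom C f) \<and>
     f \<cdot>\<^bsub>C\<^esub> g = Idn C (Dom C f) \<and> g \<cdot>\<^bsub>C\<^esub> f = Idn C (Cod C f)"

definition is_iso :: "('o, 'm) cat \<Rightarrow> 'm \<Rightarrow> bool" where
  "is_iso C f \<longleftrightarrow> (\<exists>g. is_inverse C f g)"

definition inverse_of :: "('o, 'm) cat \<Rightarrow> 'm \<Rightarrow> 'm" where
  "inverse_of C f = (THE g. is_inverse C f g)"

definition is_product :: "('o, 'm) cat \<Rightarrow> 'o \<Rightarrow> 'o \<Rightarrow> 'o \<Rightarrow> 'm \<Rightarrow> 'm \<Rightarrow> bool" where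
  "is_product C A B P p q \<longleftrightarrow> P \<in> Obj C \<and> p \<in> hom C P A \<and> q \<in> hom C P B \<and>
     (\<forall>X \<in> Obj C. \<forall>f \<in> hom C X A. \<forall>g \<in> hom C X B.
        \<exists>!h. h \<in> hom C X P \<and> h \<cdot>\<^bsub>C\<^esub> p = f \<and> h \<cdot>\<^bsub>C\<^esub> q = g)"

definition is_coproduct :: "('o, 'm) cat \<Rightarrow> 'o \<Rightarrow> 'o \<Rightarrow> 'o \<Rightarrow> 'm \<Rightarrow> 'm \<Rightarrow> bool" where
  "is_coproduct C A B P i j \<longleftrightarrow> P \<in> Obj C \<and> i \<in> hom C A P \<and> j \<in> hom C B P \<and>
     (\<forall>X \<in> Obj C. \<forall>f \<in> hom C A X. \<forall>g \<in> hom C B X.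
        \<exists>!h. h \<in> hom C P X \<and> i \<cdot>\<^bsub>C\<^esub> h = f \<and> j \<cdot>\<^bsub>C\<^esub> h = g)"


text \<open>
  Chosen objects, projections and injections. Whether the (\<open>One\<close>, \<open>Prod\<close>) part is read as ordinary
  products or as restriction products is decided by the locales below. Pairings and copairings are
  not data: they are recovered from the respective universal properties.
\<close>

record ('o, 'm) bicart =
  One    :: 'o
  Prod   :: "'o \<Rightarrow> 'o \<Rightarrow> 'o"
  Proj0  :: "'o \<Rightarrow> 'o \<Rightarrow> 'm"
  Proj1  :: "'o \<Rightarrow> 'o \<Rightarrow> 'm"
  Zro    :: 'o
  Coprod :: "'o \<Rightarrow> 'o \<Rightarrow> 'o"
  Inj0   :: "'o \<Rightarrow> 'o \<Rightarrow> 'm"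
  Inj1   :: "'o \<Rightarrow> 'o \<Rightarrow> 'm"

definition to_one :: "('o, 'm) cat \<Rightarrow> ('o, 'm) bicart \<Rightarrow> 'o \<Rightarrow> 'm" where
  "to_one C S A = (THE h. h \<in> hom C A (One S))"

definition pair :: "('o, 'm) cat \<Rightarrow> ('o, 'm) bicart \<Rightarrow> 'm \<Rightarrow> 'm \<Rightarrow> 'm" where
  "pair C S f g = (THE h. h \<in> hom C (Dom C f) (Prod S (Cod C f) (Cod C g)) \<and>
     h \<cdot>\<^bsub>C\<^esub> Proj0 S (Cod C f) (Cod C g) = f \<and> h \<cdot>\<^bsub>C\<^esub> Proj1 S (Cod C f) (Cod C g) = g)"

definition from_zro :: "('o, 'm) cat \<Rightarrow> ('o, 'm) bicart \<Rightarrow> 'o \<Rightarrow> 'm" where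
  "from_zro C S A = (THE h. h \<in> hom C (Zro S) A)"

definition copair :: "('o, 'm) cat \<Rightarrow> ('o, 'm) bicart \<Rightarrow> 'm \<Rightarrow> 'm \<Rightarrow> 'm" where
  "copair C S f g = (THE h. h \<in> hom C (Coprod S (Dom C f) (Dom C g)) (Cod C f) \<and>
     Inj0 S (Dom C f) (Dom C g) \<cdot>\<^bsub>C\<^esub> h = f \<and> Inj1 S (Dom C f) (Dom C g) \<cdot>\<^bsub>C\<^esub> h = g)"

locale cartesian_category = category +
  fixes S :: "('o, 'm) bicart"
  assumes One_Obj: "One S \<in> Obj C"
    and One_terminal: "A \<in> Obj C \<Longrightarrow> \<exists>!h. h \<in> hom C A (One S)"
    and Prod_product: "\<lbrakk>A \<in> Obj C; B \<in> Obj C\<rbrakk> \<Longrightarrow>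
      is_product C A B (Prod S A B) (Proj0 S A B) (Proj1 S A B)"

locale cocartesian_category = category +
  fixes S :: "('o, 'm) bicart"
  assumes Zro_Obj: "Zro S \<in> Obj C"
    and Zro_initial: "A \<in> Obj C \<Longrightarrow> \<exists>!h. h \<in> hom C (Zro S) A"
    and Coprod_coproduct: "\<lbrakk>A \<in> Obj C; B \<in> Obj C\<rbrakk> \<Longrightarrow>
      is_coproduct C A B (Coprod S A B) (Inj0 S A B) (Inj1 S A B)"

text \<open>
  The distributivity maps, relative to a pairing operation \<open>pr\<close>, so that they can be used for both
  ordinary and restriction products. \<open>id_times pr A B h\<close> is \<open>1\<^sub>A \<times> h = \<langle>\<pi>\<^sub>0, \<pi>\<^sub>1h\<rangle>\<close> for \<open>h\<close> with domain \<open>B\<close>.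
\<close>

definition id_times ::
  "('o, 'm) cat \<Rightarrow> ('o, 'm) bicart \<Rightarrow> ('m \<Rightarrow> 'm \<Rightarrow> 'm) \<Rightarrow> 'o \<Rightarrow> 'o \<Rightarrow> 'm \<Rightarrow> 'm" where
  "id_times C S pr A B h = pr (Proj0 S A B) (Proj1 S A B \<cdot>\<^bsub>C\<^esub> h)"

definition distr ::
  "('o, 'm) cat \<Rightarrow> ('o, 'm) bicart \<Rightarrow> ('m \<Rightarrow> 'm \<Rightarrow> 'm) \<Rightarrow> 'o \<Rightarrow> 'o \<Rightarrow> 'o \<Rightarrow> 'm" where
  "distr C S pr A B D =
     copair C S (id_times C S pr A B (Inj0 S B D)) (id_times C S pr A D (Inj1 S B D))"

definition distr0 ::
  "('o, 'm) cat \<Rightarrow> ('o, 'm) bicart \<Rightarrow> ('m \<Rightarrow> 'm \<Rightarrow> 'm) \<Rightarrow> 'o \<Rightarrow> 'm" where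
  "distr0 C S pr A = pr (from_zro C S A) (Idn C (Zro S))"

locale distributive_category = cartesian_category + cocartesian_category +
  assumes distr_iso: "\<lbrakk>A \<in> Obj C; B \<in> Obj C; D \<in> Obj C\<rbrakk> \<Longrightarrow> is_iso C (distr C S (pair C S) A B D)"
    and distr0_iso: "A \<in> Obj C \<Longrightarrow> is_iso C (distr0 C S (pair C S) A)"


locale restriction_category = category +
  fixes R :: "'m \<Rightarrow> 'm"
  assumes R_hom: "f \<in> hom C A B \<Longrightarrow> R f \<in> hom C A A"
    and R1: "f \<in> hom C A B \<Longrightarrow> R f \<cdot> f = f"
    and R2: "\<lbrakk>f \<in> hom C A B; g \<in> hom C A D\<rbrakk> \<Longrightarrow> R f \<cdot> R g = R g \<cdot> R f"
    and R3: "\<lbrakk>f \<in> hom C A B; g \<in> hom C A D\<rbrakk> \<Longrightarrow> R (R g \<cdot> f) = R g \<cdot> R f"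
    and R4: "\<lbrakk>f \<in> hom C A B; g \<in> hom C B D\<rbrakk> \<Longrightarrow> f \<cdot> R g = R (f \<cdot> g) \<cdot> f"

definition is_total :: "('o, 'm) cat \<Rightarrow> ('m \<Rightarrow> 'm) \<Rightarrow> 'm \<Rightarrow> bool" where
  "is_total C R f \<longleftrightarrow> R f = Idn C (Dom C f)"

locale restriction_zeroes = restriction_category +
  fixes Z :: "'o \<Rightarrow> 'o \<Rightarrow> 'm"
  assumes Z_hom: "\<lbrakk>A \<in> Obj C; B \<in> Obj C\<rbrakk> \<Longrightarrow> Z A B \<in> hom C A B"
    and Comp_Z: "\<lbrakk>f \<in> hom C A B; D \<in> Obj C\<rbrakk> \<Longrightarrow> f \<cdot> Z B D = Z A D"
    and Z_Comp: "\<lbrakk>A \<in> Obj C; f \<in> hom C B D\<rbrakk> \<Longrightarrow> Z A B \<cdot> f = Z A D"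
    and R_Z: "\<lbrakk>A \<in> Obj C; B \<in> Obj C\<rbrakk> \<Longrightarrow> R (Z A B) = Z A A"

definition is_restriction_product ::
  "('o, 'm) cat \<Rightarrow> ('m \<Rightarrow> 'm) \<Rightarrow> 'o \<Rightarrow> 'o \<Rightarrow> 'o \<Rightarrow> 'm \<Rightarrow> 'm \<Rightarrow> bool" where
  "is_restriction_product C R A B P p q \<longleftrightarrow>
     P \<in> Obj C \<and> p \<in> hom C P A \<and> q \<in> hom C P B \<and> is_total C R p \<and> is_total C R q \<and>
     (\<forall>X \<in> Obj C. \<forall>f \<in> hom C X A. \<forall>g \<in> hom C X B.
        \<exists>!h. h \<in> hom C X P \<and> h \<cdot>\<^bsub>C\<^esub> p = R g \<cdot>\<^bsub>C\<^esub> f \<and> h \<cdot>\<^bsub>C\<^esub> q = R f \<cdot>\<^bsub>C\<^esub> g)"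

definition rpair ::
  "('o, 'm) cat \<Rightarrow> ('m \<Rightarrow> 'm) \<Rightarrow> ('o, 'm) bicart \<Rightarrow> 'm \<Rightarrow> 'm \<Rightarrow> 'm" where
  "rpair C R S f g = (THE h. h \<in> hom C (Dom C f) (Prod S (Cod C f) (Cod C g)) \<and>
     h \<cdot>\<^bsub>C\<^esub> Proj0 S (Cod C f) (Cod C g) = R g \<cdot>\<^bsub>C\<^esub> f \<and>
     h \<cdot>\<^bsub>C\<^esub> Proj1 S (Cod C f) (Cod C g) = R f \<cdot>\<^bsub>C\<^esub> g)"

locale cartesian_restriction_category = restriction_category +
  fixes S :: "('o, 'm) bicart"
  assumes One_Obj: "One S \<in> Obj C"
    and One_total: "A \<in> Obj C \<Longrightarrow> \<exists>!t. t \<in> hom C A (One S) \<and> is_total C R t"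
    and One_restriction:
      "\<lbrakk>f \<in> hom C A B; s \<in> hom C B (One S); is_total C R s; t \<in> hom C A (One S); is_total C R t\<rbrakk>
        \<Longrightarrow> f \<cdot> s = R f \<cdot> t"
    and Prod_restriction_product: "\<lbrakk>A \<in> Obj C; B \<in> Obj C\<rbrakk> \<Longrightarrow>
      is_restriction_product C R A B (Prod S A B) (Proj0 S A B) (Proj1 S A B)"

locale cocartesian_restriction_category =
  restriction_category C R + cocartesian_category C S
  for C :: "('o, 'm) cat" (structure) and R :: "'m \<Rightarrow> 'm" and S :: "('o, 'm) bicart" +
  assumes Inj0_total: "\<lbrakk>A \<in> Obj C; B \<in> Obj C\<rbrakk> \<Longrightarrow> is_total C R (Inj0 S A B)"
    and Inj1_total: "\<lbrakk>A \<in> Obj C; B \<in> Obj C\<rbrakk> \<Longrightarrow> is_total C R (Inj1 S A B)"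

locale distributive_restriction_category =
  cartesian_restriction_category + cocartesian_restriction_category +
  assumes distr_iso:
      "\<lbrakk>A \<in> Obj C; B \<in> Obj C; D \<in> Obj C\<rbrakk> \<Longrightarrow> is_iso C (distr C S (rpair C R S) A B D)"
    and distr0_iso: "A \<in> Obj C \<Longrightarrow> is_iso C (distr0 C S (rpair C R S) A)"


text \<open>
  The ternary coproduct \<open>A \<oplus> B \<oplus> (A \<times> B)\<close> and its copairing \<open>[f, g, h]\<close> are bracketed to the left.
  The existential quantification over \<open>Z\<close> (here and for relative complements below) is harmless:
  zero maps, if they exist, are uniquely determined on the objects of \<open>C\<close>.
\<close>

definition cprod :: "('o, 'm) bicart \<Rightarrow> 'o \<Rightarrow> 'o \<Rightarrow> 'o" where
  "cprod S A B = Coprod S (Coprod S A B) (Prod S A B)"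

definition cproj0 ::
  "('o, 'm) cat \<Rightarrow> ('o, 'm) bicart \<Rightarrow> ('o \<Rightarrow> 'o \<Rightarrow> 'm) \<Rightarrow> 'o \<Rightarrow> 'o \<Rightarrow> 'm" where
  "cproj0 C S Z A B = copair C S (copair C S (Idn C A) (Z B A)) (Proj0 S A B)"

definition cproj1 ::
  "('o, 'm) cat \<Rightarrow> ('o, 'm) bicart \<Rightarrow> ('o \<Rightarrow> 'o \<Rightarrow> 'm) \<Rightarrow> 'o \<Rightarrow> 'o \<Rightarrow> 'm" where
  "cproj1 C S Z A B = copair C S (copair C S (Z A B) (Idn C B)) (Proj1 S A B)"

definition has_classical_products ::
  "('o, 'm) cat \<Rightarrow> ('m \<Rightarrow> 'm) \<Rightarrow> ('o, 'm) bicart \<Rightarrow> bool" where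
  "has_classical_products C R S \<longleftrightarrow>
     distributive_restriction_category C R S \<and>
     (\<exists>Z. restriction_zeroes C R Z \<and>
        (\<forall>A \<in> Obj C. \<forall>B \<in> Obj C.
           is_product C A B (cprod S A B) (cproj0 C S Z A B) (cproj1 C S Z A B)))"


text \<open>The following three relations are only meant for parallel maps.\<close>

definition rle :: "('o, 'm) cat \<Rightarrow> ('m \<Rightarrow> 'm) \<Rightarrow> 'm \<Rightarrow> 'm \<Rightarrow> bool" where
  "rle C R f g \<longleftrightarrow> R f \<cdot>\<^bsub>C\<^esub> g = f"

definition compatible :: "('o, 'm) cat \<Rightarrow> ('m \<Rightarrow> 'm) \<Rightarrow> 'm \<Rightarrow> 'm \<Rightarrow> bool" where
  "compatible C R f g \<longleftrightarrow> R f \<cdot>\<^bsub>C\<^esub> g = R g \<cdot>\<^bsub>C\<^esub> f"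

definition disjoint ::
  "('o, 'm) cat \<Rightarrow> ('m \<Rightarrow> 'm) \<Rightarrow> ('o \<Rightarrow> 'o \<Rightarrow> 'm) \<Rightarrow> 'm \<Rightarrow> 'm \<Rightarrow> bool" where
  "disjoint C R Z f g \<longleftrightarrow> R f \<cdot>\<^bsub>C\<^esub> g = Z (Dom C f) (Cod C g)"

definition is_join ::
  "('o, 'm) cat \<Rightarrow> ('m \<Rightarrow> 'm) \<Rightarrow> 'o \<Rightarrow> 'o \<Rightarrow> 'm set \<Rightarrow> 'm \<Rightarrow> bool" where
  "is_join C R A B F j \<longleftrightarrow> j \<in> hom C A B \<and> (\<forall>f \<in> F. rle C R f j) \<and>
     (\<forall>k \<in> hom C A B. (\<forall>f \<in> F. rle C R f k) \<longrightarrow> rle C R j k)"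

definition compatible_family ::
  "('o, 'm) cat \<Rightarrow> ('m \<Rightarrow> 'm) \<Rightarrow> 'o \<Rightarrow> 'o \<Rightarrow> 'm set \<Rightarrow> bool" where
  "compatible_family C R A B F \<longleftrightarrow>
     finite F \<and> F \<subseteq> hom C A B \<and> (\<forall>f \<in> F. \<forall>g \<in> F. compatible C R f g)"

locale join_restriction_category = restriction_category +
  assumes join_exists: "\<lbrakk>A \<in> Obj C; B \<in> Obj C; compatible_family C R A B F\<rbrakk> \<Longrightarrow>
      \<exists>j. is_join C R A B F j"
    and join_precomp:
      "\<lbrakk>A \<in> Obj C; B \<in> Obj C; compatible_family C R A B F; is_join C R A B F j; h \<in> hom C X A\<rbrakk> \<Longrightarrow>
      is_join C R X B ((\<lambda>f. h \<cdot> f) ` F) (h \<cdot> j)"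

locale classical_restriction_category = join_restriction_category +
  assumes relative_complement:
    "\<exists>Z. restriction_zeroes C R Z \<and>
       (\<forall>A \<in> Obj C. \<forall>B \<in> Obj C. \<forall>f \<in> hom C A B. \<forall>g \<in> hom C A B. rle C R f g \<longrightarrow>
          (\<exists>h \<in> hom C A B. disjoint C R Z h f \<and> is_join C R A B {h, f} g))"

locale classical_distributive_restriction_category =
  distributive_restriction_category + classical_restriction_category


text \<open>
  The Kleisli category of the exception monad. A Kleisli map \<open>A \<rightarrow> B\<close> given by \<open>f : A \<rightarrow> B \<oplus> 1\<close> is
  represented as \<open>(A, f, B)\<close>, because \<open>B\<close> cannot in general be recovered from the object \<open>B \<oplus> 1\<close>.
\<close>

definition kleisli :: "('o, 'm) cat \<Rightarrow> ('o, 'm) bicart \<Rightarrow> ('o, 'o \<times> 'm \<times> 'o) cat" where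
  "kleisli D S =
     \<lparr>Obj = Obj D,
      Arr = {(A, f, B). A \<in> Obj D \<and> B \<in> Obj D \<and> f \<in> hom D A (Coprod S B (One S))},
      Dom = (\<lambda>(A, f, B). A),
      Cod = (\<lambda>(A, f, B). B),
      Idn = (\<lambda>A. (A, Inj0 S A (One S), A)),
      Comp = (\<lambda>(A, f, B) (B', g, E). (A, f \<cdot>\<^bsub>D\<^esub> copair D S g (Inj1 S E (One S)), E))\<rparr>"

definition kleisli_rst ::
  "('o, 'm) cat \<Rightarrow> ('o, 'm) bicart \<Rightarrow> 'o \<times> 'm \<times> 'o \<Rightarrow> 'o \<times> 'm \<times> 'o" where
  "kleisli_rst D S = (\<lambda>(A, f, B).
     (A,
      pair D S (Idn D A) f
        \<cdot>\<^bsub>D\<^esub> inverse_of D (distr D S (pair D S) A B (One S))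
        \<cdot>\<^bsub>D\<^esub> copair D S (Proj0 S A B \<cdot>\<^bsub>D\<^esub> Inj0 S A (One S)) (Proj1 S A (One S) \<cdot>\<^bsub>D\<^esub> Inj1 S A (One S)),
      A))"

definition kleisli_unit ::
  "('o, 'm) cat \<Rightarrow> ('o, 'm) bicart \<Rightarrow> 'm \<Rightarrow> 'o \<times> 'm \<times> 'o" where
  "kleisli_unit D S f = (Dom D f, f \<cdot>\<^bsub>D\<^esub> Inj0 S (Cod D f) (One S), Cod D f)"

definition kleisli_bicart ::
  "('o, 'm) cat \<Rightarrow> ('o, 'm) bicart \<Rightarrow> ('o, 'o \<times> 'm \<times> 'o) bicart" where
  "kleisli_bicart D S =
     \<lparr>One = One S,
      Prod = Prod S,
      Proj0 = (\<lambda>A B. kleisli_unit D S (Proj0 S A B)),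
      Proj1 = (\<lambda>A B. kleisli_unit D S (Proj1 S A B)),
      Zro = Zro S,
      Coprod = Coprod S,
      Inj0 = (\<lambda>A B. kleisli_unit D S (Inj0 S A B)),
      Inj1 = (\<lambda>A B. kleisli_unit D S (Inj1 S A B))\<rparr>"

definition kleisli_zero ::
  "('o, 'm) cat \<Rightarrow> ('o, 'm) bicart \<Rightarrow> 'o \<Rightarrow> 'o \<Rightarrow> 'o \<times> 'm \<times> 'o" where
  "kleisli_zero D S A B = (A, to_one D S A \<cdot>\<^bsub>D\<^esub> Inj1 S B (One S), B)"

end

theory Submission
  imports Defs
begin

text \<open>
  A Kleisli map \<open>f : A \<rightarrow> B \<oplus> 1\<close> is a partial map with a decidable domain: \<open>A\<close> falls into the part
  where \<open>f\<close> has a value in \<open>B\<close> and the part where it raises the exception. Distributivity makes this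
  precise. As \<open>A \<times> (B \<oplus> 1)\<close> is a coproduct of \<open>A \<times> B\<close> and \<open>A \<times> 1\<close>, a map out of \<open>A\<close> can be defined by a
  case analysis of \<open>f\<close>, called \<open>branch\<close> below. One law, \<open>branch_substitute\<close>, governs it, and the
  identities of restriction categories and the restriction products of the Kleisli category follow by
  calculating with case analyses. Often an identity is natural in \<open>f\<close>, and then it need be verified
  only for the two injections into \<open>B \<oplus> 1\<close>. Distributivity is inherited along the unit functor from
  the base category.

  The restriction \<open>R f\<close> returns the argument where \<open>f\<close> is defined. Exchanging the two outcomes gives
  a complementary idempotent \<open>N f\<close>, which returns the argument where \<open>f\<close> is undefined. It satisfies
  \<open>R f \<cdot> N f = 0\<close> and \<open>h \<cdot> N f = N (h \<cdot> f) \<cdot> h\<close>; two maps are equal if they agree after \<open>R f\<close> and after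
  \<open>N f\<close>; and two maps can be glued to one that agrees with the first after \<open>R f\<close> and with the second
  after \<open>N f\<close>. These properties are collected in the locale \<open>complemented_restriction_category\<close>, and
  the rest is deduced from them.

  Classicality: the join of compatible \<open>f\<close> and \<open>g\<close> is \<open>f\<close> on the domain of \<open>f\<close> and \<open>g\<close> on its
  complement, and this description is stable under precomposition; finite joins are iterated binary
  ones. For \<open>f \<le> g\<close> the relative complement is \<open>N f \<cdot> g\<close>.

  Classical products: on \<open>A \<oplus> B \<oplus> A \<times> B\<close> the maps \<open>N p\<^sub>1 \<cdot> p\<^sub>0\<close>, \<open>N p\<^sub>0 \<cdot> p\<^sub>1\<close> and \<open>\<langle>p\<^sub>0, p\<^sub>1\<rangle>\<close> are the three partial
  projections to the summands, so a map into this object is determined by its composites with \<open>p\<^sub>0\<close>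
  and \<open>p\<^sub>1\<close>. Conversely, \<open>f : X \<rightarrow> A\<close> and \<open>g : X \<rightarrow> B\<close> cut \<open>X\<close> into the parts where both, only \<open>f\<close>, or only
  \<open>g\<close> is defined, or neither, and the induced map is glued from \<open>\<langle>f, g\<rangle>\<close>, \<open>f\<close>, \<open>g\<close> and \<open>0\<close> on these
  parts.
\<close>

section \<open>Composable arrows, pairings and copairings\<close>

text \<open>
  Typing is tracked by \<open>Arr\<close>, \<open>Dom\<close> and \<open>Cod\<close> rather than by \<open>hom\<close>: a rule whose premise is
  \<open>f \<in> hom C A B\<close> has \<open>A\<close> and \<open>B\<close> as extra variables, which the simplifier cannot guess, whereas
  \<open>Dom C f\<close> and \<open>Cod C f\<close> can be computed. With the rules below composites are normalised to the
  right, and pairings, copairings and constant maps absorb what is composed with them.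
\<close>

lemma hom_iff: "f \<in> hom C A B \<longleftrightarrow> f \<in> Arr C \<and> Dom C f = A \<and> Cod C f = B"
  by (simp add: hom_def)

context category
begin

lemma Comp_Arr [simp]:
  assumes "f \<in> Arr C" "g \<in> Arr C" "Cod C f = Dom C g"
  shows "f \<cdot> g \<in> Arr C" "Dom C (f \<cdot> g) = Dom C f" "Cod C (f \<cdot> g) = Cod C g"
  using Comp_hom[of f "Dom C f" "Cod C f" g "Cod C g"] assms by (auto simp: hom_iff)

lemma Idn_Arr [simp]:
  assumes "A \<in> Obj C"
  shows "Idn C A \<in> Arr C" "Dom C (Idn C A) = A" "Cod C (Idn C A) = A"
  using Idn_hom[OF assms] by (auto simp: hom_iff)

lemma Dom_Cod_Obj [simp]:
  assumes "f \<in> Arr C"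
  shows "Dom C f \<in> Obj C" "Cod C f \<in> Obj C"
  using Dom_Obj Cod_Obj assms by auto

lemma Idn_Comp_Arr [simp]: "\<lbrakk>f \<in> Arr C; Dom C f = A\<rbrakk> \<Longrightarrow> Idn C A \<cdot> f = f"
  using Idn_Comp[of f A "Cod C f"] by (simp add: hom_iff)

lemma Comp_Idn_Arr [simp]: "\<lbrakk>f \<in> Arr C; Cod C f = A\<rbrakk> \<Longrightarrow> f \<cdot> Idn C A = f"
  using Comp_Idn[of f "Dom C f" A] by (simp add: hom_iff)

lemma Comp_assoc_Arr [simp]:
  "\<lbrakk>f \<in> Arr C; g \<in> Arr C; h \<in> Arr C; Cod C f = Dom C g; Cod C g = Dom C h\<rbrakk>
    \<Longrightarrow> (f \<cdot> g) \<cdot> h = f \<cdot> (g \<cdot> h)"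
  using Comp_assoc[of f "Dom C f" "Cod C f" g "Cod C g" h "Cod C h"] by (simp add: hom_iff)

lemma is_inverse_unique:
  assumes "is_inverse C f g" "is_inverse C f g'"
  shows "g = g'"
proof -
  have types: "f \<in> Arr C" "g \<in> Arr C" "g' \<in> Arr C"
    "Dom C g = Cod C f" "Cod C g = Dom C f" "Dom C g' = Cod C f" "Cod C g' = Dom C f"
    using assms by (auto simp: is_inverse_def hom_iff)
  have "g = g \<cdot> (f \<cdot> g')"
    using assms types by (simp add: is_inverse_def)
  also have "\<dots> = (g \<cdot> f) \<cdot> g'"
    using types by simp
  also have "\<dots> = g'"
    using assms types by (simp add: is_inverse_def)
  finally show ?thesis .
qed

lemma is_inverse_inverse_of: "is_iso C f \<Longrightarrow> is_inverse C f (inverse_of C f)"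
  unfolding is_iso_def inverse_of_def by (metis is_inverse_unique theI)

end

context cartesian_category
begin

lemma One_Obj' [simp]: "One S \<in> Obj C"
  by (rule One_Obj)

lemma to_one_Arr [simp]:
  assumes "A \<in> Obj C"
  shows "to_one C S A \<in> Arr C" "Dom C (to_one C S A) = A" "Cod C (to_one C S A) = One S"
  using theI'[OF One_terminal[OF assms]] by (auto simp: to_one_def hom_iff)

lemma to_one_unique:
  assumes "f \<in> Arr C" "Cod C f = One S"
  shows "f = to_one C S (Dom C f)"
  using One_terminal[of "Dom C f"] assms to_one_Arr[of "Dom C f"] by (auto simp: hom_iff)

lemma to_one_One [simp]: "to_one C S (One S) = Idn C (One S)"
  using to_one_unique[of "Idn C (One S)"] by simp

lemma Comp_to_one [simp]:
  "\<lbrakk>f \<in> Arr C; Cod C f = A\<rbrakk> \<Longrightarrow> f \<cdot> to_one C S A = to_one C S (Dom C f)"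
  using to_one_unique[of "f \<cdot> to_one C S A"] by auto

lemma Comp_to_one_Comp [simp]:
  "\<lbrakk>f \<in> Arr C; Cod C f = A; h \<in> Arr C; Dom C h = One S\<rbrakk>
    \<Longrightarrow> f \<cdot> (to_one C S A \<cdot> h) = to_one C S (Dom C f) \<cdot> h"
  by (auto simp flip: Comp_assoc_Arr)

lemma Proj_Arr [simp]:
  assumes "A \<in> Obj C" "B \<in> Obj C"
  shows "Prod S A B \<in> Obj C"
    "Proj0 S A B \<in> Arr C" "Dom C (Proj0 S A B) = Prod S A B" "Cod C (Proj0 S A B) = A"
    "Proj1 S A B \<in> Arr C" "Dom C (Proj1 S A B) = Prod S A B" "Cod C (Proj1 S A B) = B"
  using Prod_product[OF assms] by (auto simp: is_product_def hom_iff)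

lemma pair_universal:
  assumes "f \<in> Arr C" "g \<in> Arr C" "Dom C g = Dom C f"
  shows "\<exists>!h. h \<in> hom C (Dom C f) (Prod S (Cod C f) (Cod C g)) \<and>
     h \<cdot> Proj0 S (Cod C f) (Cod C g) = f \<and> h \<cdot> Proj1 S (Cod C f) (Cod C g) = g"
  using Prod_product[of "Cod C f" "Cod C g"] assms by (auto simp: is_product_def hom_iff)

lemma pair_Arr [simp]:
  assumes "f \<in> Arr C" "g \<in> Arr C" "Dom C g = Dom C f"
  shows "pair C S f g \<in> Arr C" "Dom C (pair C S f g) = Dom C f"
    "Cod C (pair C S f g) = Prod S (Cod C f) (Cod C g)"
  using theI'[OF pair_universal[OF assms]] by (simp_all add: pair_def hom_iff)

lemma pair_Proj [simp]:
  assumes "f \<in> Arr C" "g \<in> Arr C" "Dom C g = Dom C f" "Cod C f = A" "Cod C g = B"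
  shows "pair C S f g \<cdot> Proj0 S A B = f" "pair C S f g \<cdot> Proj1 S A B = g"
  using theI'[OF pair_universal[OF assms(1-3)]] assms(4,5) by (auto simp: pair_def)

lemma pair_Proj_Comp [simp]:
  assumes "f \<in> Arr C" "g \<in> Arr C" "Dom C g = Dom C f" "Cod C f = A" "Cod C g = B"
  shows "\<lbrakk>h \<in> Arr C; Dom C h = A\<rbrakk> \<Longrightarrow> pair C S f g \<cdot> (Proj0 S A B \<cdot> h) = f \<cdot> h"
    "\<lbrakk>h \<in> Arr C; Dom C h = B\<rbrakk> \<Longrightarrow> pair C S f g \<cdot> (Proj1 S A B \<cdot> h) = g \<cdot> h"
  using assms by (auto simp flip: Comp_assoc_Arr)

lemma pair_unique:
  assumes "f \<in> Arr C" "g \<in> Arr C" "Dom C g = Dom C f" "Cod C f = A" "Cod C g = B"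
    "h \<in> Arr C" "Dom C h = Dom C f" "Cod C h = Prod S A B"
    "h \<cdot> Proj0 S A B = f" "h \<cdot> Proj1 S A B = g"
  shows "pair C S f g = h"
  unfolding pair_def
  by (rule the1_equality[OF pair_universal]) (use assms in \<open>auto simp: hom_iff\<close>)

lemma Comp_pair [simp]:
  assumes "f \<in> Arr C" "g \<in> Arr C" "Dom C g = Dom C f" "h \<in> Arr C" "Cod C h = Dom C f"
  shows "h \<cdot> pair C S f g = pair C S (h \<cdot> f) (h \<cdot> g)"
  by (rule pair_unique[where A = "Cod C f" and B = "Cod C g", symmetric]) (use assms in simp_all)

lemma Comp_pair_Comp [simp]:
  assumes "f \<in> Arr C" "g \<in> Arr C" "Dom C g = Dom C f" "h \<in> Arr C" "Cod C h = Dom C f"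
    "k \<in> Arr C" "Dom C k = Prod S (Cod C f) (Cod C g)"
  shows "h \<cdot> (pair C S f g \<cdot> k) = pair C S (h \<cdot> f) (h \<cdot> g) \<cdot> k"
  using assms by (simp flip: Comp_assoc_Arr)

lemma pair_Proj0_Proj1 [simp]:
  "\<lbrakk>A \<in> Obj C; B \<in> Obj C\<rbrakk> \<Longrightarrow> pair C S (Proj0 S A B) (Proj1 S A B) = Idn C (Prod S A B)"
  by (rule pair_unique[where A = A and B = B]) simp_all

end

context cocartesian_category
begin

lemma Zro_Obj' [simp]: "Zro S \<in> Obj C"
  by (rule Zro_Obj)

lemma from_zro_Arr [simp]:
  assumes "A \<in> Obj C"
  shows "from_zro C S A \<in> Arr C" "Dom C (from_zro C S A) = Zro S" "Cod C (from_zro C S A) = A"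
  using theI'[OF Zro_initial[OF assms]] by (auto simp: from_zro_def hom_iff)

lemma from_zro_unique:
  assumes "f \<in> Arr C" "Dom C f = Zro S" "Cod C f = A"
  shows "from_zro C S A = f"
  using Zro_initial[of A] assms from_zro_Arr[of A] by (auto simp: hom_iff)

lemma Inj_Arr [simp]:
  assumes "A \<in> Obj C" "B \<in> Obj C"
  shows "Coprod S A B \<in> Obj C"
    "Inj0 S A B \<in> Arr C" "Cod C (Inj0 S A B) = Coprod S A B" "Dom C (Inj0 S A B) = A"
    "Inj1 S A B \<in> Arr C" "Cod C (Inj1 S A B) = Coprod S A B" "Dom C (Inj1 S A B) = B"
  using Coprod_coproduct[OF assms] by (auto simp: is_coproduct_def hom_iff)

lemma copair_universal:
  assumes "f \<in> Arr C" "g \<in> Arr C" "Cod C g = Cod C f"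
  shows "\<exists>!h. h \<in> hom C (Coprod S (Dom C f) (Dom C g)) (Cod C f) \<and>
     Inj0 S (Dom C f) (Dom C g) \<cdot> h = f \<and> Inj1 S (Dom C f) (Dom C g) \<cdot> h = g"
  using Coprod_coproduct[of "Dom C f" "Dom C g"] assms by (auto simp: is_coproduct_def hom_iff)

lemma copair_Arr [simp]:
  assumes "f \<in> Arr C" "g \<in> Arr C" "Cod C g = Cod C f"
  shows "copair C S f g \<in> Arr C" "Cod C (copair C S f g) = Cod C f"
    "Dom C (copair C S f g) = Coprod S (Dom C f) (Dom C g)"
  using theI'[OF copair_universal[OF assms]] by (simp_all add: copair_def hom_iff)

lemma Inj_copair [simp]:
  assumes "f \<in> Arr C" "g \<in> Arr C" "Cod C g = Cod C f" "Dom C f = A" "Dom C g = B"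
  shows "Inj0 S A B \<cdot> copair C S f g = f" "Inj1 S A B \<cdot> copair C S f g = g"
  using theI'[OF copair_universal[OF assms(1-3)]] assms(4,5) by (auto simp: copair_def)

lemma Inj_copair_Comp [simp]:
  assumes "f \<in> Arr C" "g \<in> Arr C" "Cod C g = Cod C f" "Dom C f = A" "Dom C g = B"
    "h \<in> Arr C" "Dom C h = Cod C f"
  shows "Inj0 S A B \<cdot> (copair C S f g \<cdot> h) = f \<cdot> h"
    "Inj1 S A B \<cdot> (copair C S f g \<cdot> h) = g \<cdot> h"
  using assms by (auto simp flip: Comp_assoc_Arr)

lemma copair_unique:
  assumes "f \<in> Arr C" "g \<in> Arr C" "Cod C g = Cod C f" "Dom C f = A" "Dom C g = B"
    "h \<in> Arr C" "Cod C h = Cod C f" "Dom C h = Coprod S A B"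
    "Inj0 S A B \<cdot> h = f" "Inj1 S A B \<cdot> h = g"
  shows "copair C S f g = h"
  unfolding copair_def
  by (rule the1_equality[OF copair_universal]) (use assms in \<open>auto simp: hom_iff\<close>)

lemma copair_eqI:
  assumes "h \<in> Arr C" "Dom C h = Coprod S A B" "k \<in> Arr C" "Dom C k = Coprod S A B"
    "Cod C k = Cod C h" "A \<in> Obj C" "B \<in> Obj C"
    "Inj0 S A B \<cdot> h = Inj0 S A B \<cdot> k" "Inj1 S A B \<cdot> h = Inj1 S A B \<cdot> k"
  shows "h = k"
proof -
  have "copair C S (Inj0 S A B \<cdot> h) (Inj1 S A B \<cdot> h) = h"
    by (rule copair_unique[where A = A and B = B]) (use assms in simp_all)
  moreover have "copair C S (Inj0 S A B \<cdot> h) (Inj1 S A B \<cdot> h) = k"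
    by (rule copair_unique[where A = A and B = B]) (use assms in simp_all)
  ultimately show ?thesis by simp
qed

lemma copair_Comp [simp]:
  assumes "f \<in> Arr C" "g \<in> Arr C" "Cod C g = Cod C f" "h \<in> Arr C" "Dom C h = Cod C f"
  shows "copair C S f g \<cdot> h = copair C S (f \<cdot> h) (g \<cdot> h)"
  by (rule copair_unique[where A = "Dom C f" and B = "Dom C g", symmetric]) (use assms in simp_all)

lemma copair_Inj [simp]:
  "\<lbrakk>A \<in> Obj C; B \<in> Obj C\<rbrakk> \<Longrightarrow> copair C S (Inj0 S A B) (Inj1 S A B) = Idn C (Coprod S A B)"
  by (rule copair_unique[where A = A and B = B]) simp_all

end

section \<open>Restriction categories with complements\<close>

text \<open>
  \<open>N f\<close> is the complement of the restriction idempotent of \<open>f\<close>. The axioms say that the domain of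
  \<open>f\<close> and its complement are disjoint, are stable under precomposition, and together behave like a
  decomposition of \<open>A\<close> into two pieces: maps out of \<open>A\<close> may be compared piecewise and defined
  piecewise.
\<close>
locale complemented_restriction_category = restriction_zeroes +
  fixes N :: "'b \<Rightarrow> 'b"
  assumes N_hom: "f \<in> hom C A B \<Longrightarrow> N f \<in> hom C A A"
    and R_N: "f \<in> hom C A B \<Longrightarrow> R (N f) = N f"
    and R_Comp_N: "f \<in> hom C A B \<Longrightarrow> R f \<cdot> N f = Z A A"
    and Comp_N: "\<lbrakk>f \<in> hom C A B; g \<in> hom C B D\<rbrakk> \<Longrightarrow> f \<cdot> N g = N (f \<cdot> g) \<cdot> f"
    and separation: "\<lbrakk>f \<in> hom C A B; h \<in> hom C A D; k \<in> hom C A D;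
      R f \<cdot> h = R f \<cdot> k; N f \<cdot> h = N f \<cdot> k\<rbrakk> \<Longrightarrow> h = k"
    and glueing: "\<lbrakk>f \<in> hom C A B; h \<in> hom C A D; k \<in> hom C A D\<rbrakk>
      \<Longrightarrow> \<exists>m \<in> hom C A D. R f \<cdot> m = R f \<cdot> h \<and> N f \<cdot> m = N f \<cdot> k"
begin

lemma R_N_Arr [simp]:
  assumes "f \<in> Arr C"
  shows "R f \<in> Arr C" "Dom C (R f) = Dom C f" "Cod C (R f) = Dom C f"
    "N f \<in> Arr C" "Dom C (N f) = Dom C f" "Cod C (N f) = Dom C f"
  using R_hom[of f "Dom C f" "Cod C f"] N_hom[of f "Dom C f" "Cod C f"] assms
  by (auto simp: hom_iff)

lemma Z_Arr [simp]:
  assumes "A \<in> Obj C" "B \<in> Obj C"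
  shows "Z A B \<in> Arr C" "Dom C (Z A B) = A" "Cod C (Z A B) = B"
  using Z_hom[OF assms] by (auto simp: hom_iff)

lemma Comp_Z_Arr [simp]:
  "\<lbrakk>f \<in> Arr C; Cod C f = B; D \<in> Obj C\<rbrakk> \<Longrightarrow> f \<cdot> Z B D = Z (Dom C f) D"
  "\<lbrakk>f \<in> Arr C; Dom C f = B; A \<in> Obj C\<rbrakk> \<Longrightarrow> Z A B \<cdot> f = Z A (Cod C f)"
  using Comp_Z[of f "Dom C f" B D] Z_Comp[of A f B "Cod C f"] by (simp_all add: hom_iff)

lemma R_Z_Arr [simp]: "\<lbrakk>A \<in> Obj C; B \<in> Obj C\<rbrakk> \<Longrightarrow> R (Z A B) = Z A A"
  by (rule R_Z)

lemma R_absorb [simp]: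
  "f \<in> Arr C \<Longrightarrow> R f \<cdot> f = f"
  "\<lbrakk>f \<in> Arr C; h \<in> Arr C; Dom C h = Cod C f\<rbrakk> \<Longrightarrow> R f \<cdot> (f \<cdot> h) = f \<cdot> h"
proof -
  show *: "R f \<cdot> f = f" if "f \<in> Arr C" for f
    using R1[of f "Dom C f" "Cod C f"] that by (simp add: hom_iff)
  show "\<lbrakk>f \<in> Arr C; h \<in> Arr C; Dom C h = Cod C f\<rbrakk> \<Longrightarrow> R f \<cdot> (f \<cdot> h) = f \<cdot> h"
    using * by (simp flip: Comp_assoc_Arr)
qed

lemma R_commute:
  assumes "f \<in> Arr C" "g \<in> Arr C" "Dom C f = Dom C g"
  shows "R f \<cdot> R g = R g \<cdot> R f"
  using R2[of f "Dom C f" "Cod C f" g "Cod C g"] assms by (simp add: hom_iff)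

lemma R_N_Arr_eq [simp]: "f \<in> Arr C \<Longrightarrow> R (N f) = N f"
  using R_N[of f "Dom C f" "Cod C f"] by (simp add: hom_iff)

lemma guard_commute:
  assumes "f \<in> Arr C" "g \<in> Arr C" "Dom C f = Dom C g"
  shows "R f \<cdot> R g = R g \<cdot> R f" "R f \<cdot> N g = N g \<cdot> R f" "N f \<cdot> N g = N g \<cdot> N f"
  using R_commute[of f g] R_commute[of f "N g"] R_commute[of "N f" "N g"] assms by simp_all

lemma guard_left_commute:
  assumes "f \<in> Arr C" "g \<in> Arr C" "Dom C f = Dom C g" "h \<in> Arr C" "Dom C h = Dom C g"
  shows "R f \<cdot> (R g \<cdot> h) = R g \<cdot> (R f \<cdot> h)" "R f \<cdot> (N g \<cdot> h) = N g \<cdot> (R f \<cdot> h)"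
    "N f \<cdot> (N g \<cdot> h) = N g \<cdot> (N f \<cdot> h)"
  using guard_commute[OF assms(1-3)] assms by (simp_all flip: Comp_assoc_Arr)

lemma R_guarded:
  assumes "f \<in> Arr C" "g \<in> Arr C" "Dom C f = Dom C g"
  shows "R (R g \<cdot> f) = R g \<cdot> R f" "R (N g \<cdot> f) = N g \<cdot> R f"
  using R3[of f "Dom C f" "Cod C f" g "Cod C g"] R3[of f "Dom C f" "Cod C f" "N g" "Dom C f"] assms
  by (simp_all add: hom_iff)

lemma Comp_R:
  assumes "f \<in> Arr C" "g \<in> Arr C" "Cod C f = Dom C g"
  shows "f \<cdot> R g = R (f \<cdot> g) \<cdot> f"
  using R4[of f "Dom C f" "Cod C f" g "Cod C g"] assms by (simp add: hom_iff)

lemma Comp_N_Arr: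
  assumes "f \<in> Arr C" "g \<in> Arr C" "Cod C f = Dom C g"
  shows "f \<cdot> N g = N (f \<cdot> g) \<cdot> f"
  using Comp_N[of f "Dom C f" "Cod C f" g "Cod C g"] assms by (simp add: hom_iff)

lemma R_idem [simp]:
  "f \<in> Arr C \<Longrightarrow> R (R f) = R f" 
  using R_guarded(1)[of "Idn C (Dom C f)" f] R_absorb(1)[of "Idn C (Dom C f)"] by simp

lemma guard_idem [simp]:
  assumes "f \<in> Arr C"
  shows "R f \<cdot> R f = R f" "N f \<cdot> N f = N f"
    "\<lbrakk>h \<in> Arr C; Dom C h = Dom C f\<rbrakk> \<Longrightarrow> R f \<cdot> (R f \<cdot> h) = R f \<cdot> h"
    "\<lbrakk>h \<in> Arr C; Dom C h = Dom C f\<rbrakk> \<Longrightarrow> N f \<cdot> (N f \<cdot> h) = N f \<cdot> h"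
  using R_absorb(1)[of "R f"] R_absorb(1)[of "N f"] R_absorb(2)[of "R f" h] R_absorb(2)[of "N f" h] assms
  by simp_all

lemma guard_disjoint [simp]:
  assumes "f \<in> Arr C"
  shows "R f \<cdot> N f = Z (Dom C f) (Dom C f)" "N f \<cdot> R f = Z (Dom C f) (Dom C f)"
    "\<lbrakk>h \<in> Arr C; Dom C h = Dom C f\<rbrakk> \<Longrightarrow> R f \<cdot> (N f \<cdot> h) = Z (Dom C f) (Cod C h)"
    "\<lbrakk>h \<in> Arr C; Dom C h = Dom C f\<rbrakk> \<Longrightarrow> N f \<cdot> (R f \<cdot> h) = Z (Dom C f) (Cod C h)"
    "N f \<cdot> f = Z (Dom C f) (Cod C f)"
proof -
  show 1: "R f \<cdot> N f = Z (Dom C f) (Dom C f)"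
    using R_Comp_N[of f "Dom C f" "Cod C f"] assms by (simp add: hom_iff)
  show 2: "N f \<cdot> R f = Z (Dom C f) (Dom C f)"
    using 1 guard_commute(2)[of f f] assms by simp
  show "\<lbrakk>h \<in> Arr C; Dom C h = Dom C f\<rbrakk> \<Longrightarrow> R f \<cdot> (N f \<cdot> h) = Z (Dom C f) (Cod C h)"
    using 1 assms by (simp flip: Comp_assoc_Arr)
  show 4: "\<lbrakk>h \<in> Arr C; Dom C h = Dom C f\<rbrakk> \<Longrightarrow> N f \<cdot> (R f \<cdot> h) = Z (Dom C f) (Cod C h)" for h
    using 2 assms by (simp flip: Comp_assoc_Arr)
  show "N f \<cdot> f = Z (Dom C f) (Cod C f)"
    using 4[of f] assms by simp
qed

lemma separation_Arr:
  assumes "f \<in> Arr C" "h \<in> Arr C" "k \<in> Arr C" "Dom C h = Dom C f" "Dom C k = Dom C f"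
    "Cod C h = Cod C k" "R f \<cdot> h = R f \<cdot> k" "N f \<cdot> h = N f \<cdot> k"
  shows "h = k"
  using separation[of f "Dom C f" "Cod C f" h "Cod C k" k] assms by (simp add: hom_iff)

lemma glue:
  assumes "f \<in> Arr C" "h \<in> Arr C" "k \<in> Arr C" "Dom C h = Dom C f" "Dom C k = Dom C f"
    "Cod C h = B" "Cod C k = B"
  obtains m where "m \<in> Arr C" "Dom C m = Dom C f" "Cod C m = B"
    "R f \<cdot> m = R f \<cdot> h" "N f \<cdot> m = N f \<cdot> k"
  using glueing[of f "Dom C f" "Cod C f" h B k] assms by (auto simp: hom_iff)

text \<open>
  The join of compatible \<open>f\<close> and \<open>g\<close> is defined piecewise, as \<open>f\<close> on the domain of \<open>f\<close> and as \<open>g\<close> on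
  its complement. Compatibility is what places \<open>g\<close> below it; all inequalities are checked on the two
  pieces.
\<close>
lemma binary_join:
  assumes "f \<in> hom C A B" "g \<in> hom C A B" "compatible C R f g"
    "m \<in> hom C A B" "R f \<cdot> m = f" "N f \<cdot> m = N f \<cdot> g"
  shows "is_join C R A B {f, g} m"
proof -
  have arr: "f \<in> Arr C" "Dom C f = A" "Cod C f = B" "g \<in> Arr C" "Dom C g = A" "Cod C g = B"
    "m \<in> Arr C" "Dom C m = A" "Cod C m = B" "A \<in> Obj C" "B \<in> Obj C"
    using assms by (auto simp: hom_iff)
  have fg: "R f \<cdot> g = R g \<cdot> f"
    using assms(3) by (simp add: compatible_def)
  have "R g \<cdot> m = g"
  proof (rule separation_Arr[of f])
    show "R f \<cdot> (R g \<cdot> m) = R f \<cdot> g"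
      using arr fg assms(5) by (simp add: guard_left_commute(1)[of f g])
    have "N f \<cdot> (R g \<cdot> m) = R g \<cdot> (N f \<cdot> m)"
      using arr by (simp add: guard_left_commute(2)[of g f])
    also have "\<dots> = N f \<cdot> (R g \<cdot> g)"
      using arr assms(6) by (simp add: guard_left_commute(2)[of g f] del: R_absorb)
    finally show "N f \<cdot> (R g \<cdot> m) = N f \<cdot> g"
      using arr by simp
  qed (use arr in simp_all)
  moreover have "R m \<cdot> k = m" if k: "k \<in> hom C A B" "R f \<cdot> k = f" "R g \<cdot> k = g" for k
  proof (rule separation_Arr[of f])
    have arr_k: "k \<in> Arr C" "Dom C k = A" "Cod C k = B"
      using k by (auto simp: hom_iff)
    have "R f \<cdot> (R m \<cdot> k) = R (R f \<cdot> m) \<cdot> k"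
      using arr arr_k by (simp add: R_guarded)
    then show "R f \<cdot> (R m \<cdot> k) = R f \<cdot> m"
      using assms(5) k by simp
    have "N f \<cdot> (R m \<cdot> k) = R (N f \<cdot> m) \<cdot> k"
      using arr arr_k by (simp add: R_guarded)
    also have "\<dots> = N f \<cdot> (R g \<cdot> k)"
      using arr arr_k by (simp add: R_guarded assms(6))
    finally show "N f \<cdot> (R m \<cdot> k) = N f \<cdot> m"
      using assms(6) k by simp
  qed (use arr k in \<open>simp_all add: hom_iff\<close>)
  ultimately show ?thesis
    using assms by (auto simp: is_join_def rle_def)
qed

text \<open>
  Both \<open>R\<close> and \<open>N\<close> are stable under precomposition, so \<open>h \<cdot> m\<close> satisfies the equations that
  characterise the piecewise join of \<open>h \<cdot> f\<close> and \<open>h \<cdot> g\<close>.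
\<close>
lemma binary_join_Comp:
  assumes "f \<in> hom C A B" "g \<in> hom C A B" "compatible C R f g"
    "m \<in> hom C A B" "R f \<cdot> m = f" "N f \<cdot> m = N f \<cdot> g" "h \<in> hom C X A"
  shows "is_join C R X B {h \<cdot> f, h \<cdot> g} (h \<cdot> m)"
proof (rule binary_join)
  have arr: "f \<in> Arr C" "Dom C f = A" "Cod C f = B" "g \<in> Arr C" "Dom C g = A" "Cod C g = B"
    "m \<in> Arr C" "Dom C m = A" "Cod C m = B" "h \<in> Arr C" "Dom C h = X" "Cod C h = A"
    using assms by (auto simp: hom_iff)
  have R: "R (h \<cdot> x) \<cdot> (h \<cdot> y) = h \<cdot> (R x \<cdot> y)" 
    and N: "N (h \<cdot> x) \<cdot> (h \<cdot> y) = h \<cdot> (N x \<cdot> y)"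
    if "x \<in> Arr C" "Dom C x = A" "y \<in> Arr C" "Dom C y = A" for x y
    using arr that Comp_R[of h x] Comp_N_Arr[of h x] by (simp_all flip: Comp_assoc_Arr)
  show "h \<cdot> f \<in> hom C X B" "h \<cdot> g \<in> hom C X B" "h \<cdot> m \<in> hom C X B"
    using arr by (simp_all add: hom_iff)
  show "compatible C R (h \<cdot> f) (h \<cdot> g)"
    using arr assms(3) by (simp add: compatible_def R)
  show "R (h \<cdot> f) \<cdot> (h \<cdot> m) = h \<cdot> f" "N (h \<cdot> f) \<cdot> (h \<cdot> m) = N (h \<cdot> f) \<cdot> (h \<cdot> g)"
    using arr assms(5,6) by (simp_all add: R N)
qed

lemma rle_trans:
  assumes "f \<in> hom C A B" "g \<in> hom C A B" "h \<in> hom C A B" "rle C R f g" "rle C R g h"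
  shows "rle C R f h"
proof -
  have "R f \<cdot> h = R (R f \<cdot> g) \<cdot> h"
    using assms by (simp add: rle_def)
  also have "\<dots> = R f \<cdot> (R g \<cdot> h)"
    using assms by (simp add: R_guarded hom_iff)
  finally show ?thesis
    using assms by (simp add: rle_def)
qed

lemma rle_antisym:
  assumes "f \<in> hom C A B" "g \<in> hom C A B" "rle C R f g" "rle C R g f"
  shows "f = g"
proof -
  have "f = R f \<cdot> (R g \<cdot> f)"
    using assms by (simp add: rle_def)
  also have "\<dots> = R g \<cdot> f"
    using assms by (simp add: guard_left_commute(1)[of f g] hom_iff)
  finally show ?thesis
    using assms by (simp add: rle_def)
qed

lemma is_join_unique:
  assumes "is_join C R A B F j" "is_join C R A B F k"
  shows "j = k"
  using assms by (intro rle_antisym[of j A B k]) (auto simp: is_join_def)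

lemma is_join_insert:
  assumes "is_join C R A B F j" "is_join C R A B {f, j} m" "f \<in> hom C A B" "F \<subseteq> hom C A B"
  shows "is_join C R A B (insert f F) m"
  unfolding is_join_def
proof (intro conjI ballI impI)
  show "m \<in> hom C A B"
    using assms by (simp add: is_join_def)
next
  fix x assume "x \<in> insert f F"
  then show "rle C R x m"
    using assms by (auto simp: is_join_def intro: rle_trans[of x A B j m])
next
  fix k assume "k \<in> hom C A B" "\<forall>x\<in>insert f F. rle C R x k"
  then show "rle C R m k"
    using assms by (simp add: is_join_def)
qed

text \<open>
  Induction on the family, adding one map at a time by a binary join. The last conjunct carries the
  induction: the new map has to be compatible with the join of the others.
\<close>
lemma finite_join:
  assumes "compatible_family C R A B F" "A \<in> Obj C" "B \<in> Obj C"
  shows "\<exists>j. is_join C R A B F j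
    \<and> (\<forall>X. \<forall>h \<in> hom C X A. is_join C R X B ((\<lambda>f. h \<cdot> f) ` F) (h \<cdot> j))
    \<and> (\<forall>g \<in> hom C A B. (\<forall>f \<in> F. compatible C R g f) \<longrightarrow> compatible C R g j)"
proof -
  have "finite F"
    using assms(1) by (simp add: compatible_family_def)
  then show ?thesis
    using assms(1)
  proof (induction F)
    case empty
    have Z: "is_join C R X B {} (Z X B)" if "X \<in> Obj C" for X
      using that assms by (auto simp: is_join_def rle_def hom_iff)
    have "is_join C R X B ((\<lambda>f. h \<cdot> f) ` {}) (h \<cdot> Z A B)" if "h \<in> hom C X A" for X h
      using Z[of X] that assms by (auto simp: hom_iff)
    moreover have "compatible C R g (Z A B)" if "g \<in> hom C A B" for g
      using that assms by (auto simp: compatible_def hom_iff)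
    ultimately show ?case
      using Z[OF assms(2)] by blast
  next
    case (insert f F)
    have F: "compatible_family C R A B F" "F \<subseteq> hom C A B" and f: "f \<in> hom C A B"
      "\<forall>x\<in>F. compatible C R f x"
      using insert.prems by (auto simp: compatible_family_def)
    obtain j where j: "is_join C R A B F j"
      and j_Comp: "\<And>X h. h \<in> hom C X A \<Longrightarrow> is_join C R X B ((\<lambda>f. h \<cdot> f) ` F) (h \<cdot> j)"
      and j_comp: "\<And>g. \<lbrakk>g \<in> hom C A B; \<forall>f \<in> F. compatible C R g f\<rbrakk> \<Longrightarrow> compatible C R g j"
      using insert.IH[OF F(1)] by blast
    have jh: "j \<in> hom C A B"
      using j by (simp add: is_join_def)
    have fj: "compatible C R f j"
      using j_comp f by simp
    have arr: "f \<in> Arr C" "Dom C f = A" "Cod C f = B" "j \<in> Arr C" "Dom C j = A" "Cod C j = B"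
      using f jh by (auto simp: hom_iff)
    obtain m where m: "m \<in> Arr C" "Dom C m = A" "Cod C m = B"
      "R f \<cdot> m = f" "N f \<cdot> m = N f \<cdot> j"
      using glue[of f f j B] arr by auto
    have mh: "m \<in> hom C A B"
      using m by (simp add: hom_iff)
    have "is_join C R A B (insert f F) m"
      using is_join_insert[OF j _ f(1) F(2)] binary_join[OF f(1) jh fj mh m(4,5)] by simp
    moreover have "is_join C R X B ((\<lambda>f. h \<cdot> f) ` insert f F) (h \<cdot> m)" if h: "h \<in> hom C X A" for X h
    proof -
      have "h \<cdot> x \<in> hom C X B" if "x \<in> hom C A B" for x
        using h that by (auto simp: hom_iff)
      then have "(\<lambda>f. h \<cdot> f) ` F \<subseteq> hom C X B" "h \<cdot> f \<in> hom C X B"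
        using f F by auto
      then show ?thesis
        using is_join_insert[OF j_Comp[OF h]] binary_join_Comp[OF f(1) jh fj mh m(4,5) h] by simp
    qed
    moreover have "compatible C R g m"
      if g: "g \<in> hom C A B" "\<forall>x \<in> insert f F. compatible C R g x" for g
    proof -
      have gf: "R g \<cdot> f = R f \<cdot> g" and gj: "R g \<cdot> j = R j \<cdot> g"
        using g j_comp by (auto simp: compatible_def)
      have garr: "g \<in> Arr C" "Dom C g = A" "Cod C g = B"
        using g by (auto simp: hom_iff)
      have "R g \<cdot> m = R m \<cdot> g"
      proof (rule separation_Arr[of f])
        have "R f \<cdot> (R g \<cdot> m) = R g \<cdot> (R f \<cdot> m)"
          using arr garr m(1-3) by (simp add: guard_left_commute(1)[of f g])
        also have "\<dots> = R (R f \<cdot> m) \<cdot> g"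
          using gf by (simp add: m(4))
        also have "\<dots> = R f \<cdot> (R m \<cdot> g)"
          using arr garr m(1-3) by (simp add: R_guarded)
        finally show "R f \<cdot> (R g \<cdot> m) = R f \<cdot> (R m \<cdot> g)" .
        have "N f \<cdot> (R g \<cdot> m) = R g \<cdot> (N f \<cdot> m)"
          using arr garr m(1-3) by (simp add: guard_left_commute(2)[of g f])
        also have "\<dots> = N f \<cdot> (R g \<cdot> j)"
          using arr garr m by (simp add: guard_left_commute(2)[of g f])
        also have "\<dots> = R (N f \<cdot> m) \<cdot> g"
          unfolding m(5) gj using arr garr m(1-3) by (simp add: R_guarded)
        also have "\<dots> = N f \<cdot> (R m \<cdot> g)"
          using arr garr m(1-3) by (simp add: R_guarded)
        finally show "N f \<cdot> (R g \<cdot> m) = N f \<cdot> (R m \<cdot> g)" .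
      qed (use arr garr m in simp_all)
      then show ?thesis
        by (simp add: compatible_def)
    qed
    ultimately show ?case by blast
  qed
qed

text \<open>The relative complement of \<open>f \<le> g\<close> is \<open>g\<close> restricted to the complement of the domain of \<open>f\<close>.\<close>
lemma classical: "classical_restriction_category C R"
proof
  fix A B F assume F: "A \<in> Obj C" "B \<in> Obj C" "compatible_family C R A B F"
  then show "\<exists>j. is_join C R A B F j"
    using finite_join by blast
  fix j h X assume "is_join C R A B F j" "h \<in> hom C X A"
  then show "is_join C R X B ((\<lambda>f. h \<cdot> f) ` F) (h \<cdot> j)"
    using finite_join[of A B F] F is_join_unique by blast
next
  have "\<exists>h \<in> hom C A B. disjoint C R Z h f \<and> is_join C R A B {h, f} g"
    if "f \<in> hom C A B" "g \<in> hom C A B" "rle C R f g" for A B f g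
  proof
    have arr: "f \<in> Arr C" "Dom C f = A" "Cod C f = B" "g \<in> Arr C" "Dom C g = A" "Cod C g = B"
      "A \<in> Obj C" "B \<in> Obj C" and fg: "R f \<cdot> g = f"
      using that by (auto simp: hom_iff rle_def)
    let ?h = "N f \<cdot> g"
    show h: "?h \<in> hom C A B"
      using arr by (simp add: hom_iff)
    have "R ?h \<cdot> f = R g \<cdot> (N f \<cdot> f)"
      using arr by (simp add: R_guarded guard_left_commute(2)[of g f] del: guard_disjoint(5))
    then have hf: "R ?h \<cdot> f = Z A B"
      using arr by simp
    have "compatible C R f ?h"
      using arr hf by (simp add: compatible_def)
    then have "is_join C R A B {f, ?h} g"
      by (rule binary_join[OF that(1) h]) (use that arr fg in simp_all)
    then show "disjoint C R Z ?h f \<and> is_join C R A B {?h, f} g"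
      using hf arr by (simp add: disjoint_def insert_commute)
  qed
  then show "\<exists>Z. restriction_zeroes C R Z \<and>
       (\<forall>A \<in> Obj C. \<forall>B \<in> Obj C. \<forall>f \<in> hom C A B. \<forall>g \<in> hom C A B. rle C R f g \<longrightarrow>
          (\<exists>h \<in> hom C A B. disjoint C R Z h f \<and> is_join C R A B {h, f} g))"
    using restriction_zeroes_axioms by blast
qed

end

section \<open>Classical products\<close>

locale complemented_distributive_restriction_category =
  complemented_restriction_category C R Z N + distributive_restriction_category C R S
  for C :: "('o, 'm) cat" (structure) and R :: "'m \<Rightarrow> 'm" and Z :: "'o \<Rightarrow> 'o \<Rightarrow> 'm"
    and N :: "'m \<Rightarrow> 'm" and S :: "('o, 'm) bicart"
begin

lemma R_Idn [simp]: "A \<in> Obj C \<Longrightarrow> R (Idn C A) = Idn C A"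
  using R_absorb(1)[of "Idn C A"] Comp_Idn_Arr[of "R (Idn C A)" A] by simp

lemma N_total:
  assumes "f \<in> Arr C" "R f = Idn C (Dom C f)"
  shows "N f = Z (Dom C f) (Dom C f)"
  using guard_disjoint(1)[of f] assms by simp

lemma N_Idn [simp]: "A \<in> Obj C \<Longrightarrow> N (Idn C A) = Z A A"
  using N_total[of "Idn C A"] by simp

lemma N_Z [simp]:
  assumes "A \<in> Obj C" "B \<in> Obj C"
  shows "N (Z A B) = Idn C A"
  by (rule separation_Arr[of "Z A B"])
     (use assms guard_idem(2)[of "Z A B"] in simp_all)

lemma R_Comp_total:
  assumes "f \<in> Arr C" "g \<in> Arr C" "Cod C f = Dom C g" "R g = Idn C (Dom C g)"
  shows "R (f \<cdot> g) = R f"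
proof -
  have "R f = R (R (f \<cdot> g) \<cdot> f)"
    using Comp_R[of f g] assms by simp
  also have "\<dots> = R (R f \<cdot> (f \<cdot> g))"
    using assms R_commute[of f "f \<cdot> g"] by (simp add: R_guarded del: R_absorb)
  finally show ?thesis
    using assms by simp
qed

lemma Proj_Arr [simp]:
  assumes "A \<in> Obj C" "B \<in> Obj C"
  shows "Prod S A B \<in> Obj C"
    "Proj0 S A B \<in> Arr C" "Dom C (Proj0 S A B) = Prod S A B" "Cod C (Proj0 S A B) = A"
    "Proj1 S A B \<in> Arr C" "Dom C (Proj1 S A B) = Prod S A B" "Cod C (Proj1 S A B) = B"
    "R (Proj0 S A B) = Idn C (Prod S A B)" "R (Proj1 S A B) = Idn C (Prod S A B)"
    "N (Proj0 S A B) = Z (Prod S A B) (Prod S A B)" "N (Proj1 S A B) = Z (Prod S A B) (Prod S A B)"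
  using Prod_restriction_product[OF assms] N_total[of "Proj0 S A B"] N_total[of "Proj1 S A B"]
  by (auto simp: is_restriction_product_def is_total_def hom_iff)

lemma restriction_pair:
  assumes "A \<in> Obj C" "B \<in> Obj C" "f \<in> Arr C" "g \<in> Arr C" "Dom C g = Dom C f"
    "Cod C f = A" "Cod C g = B"
  obtains r where "r \<in> Arr C" "Dom C r = Dom C f" "Cod C r = Prod S A B"
    "r \<cdot> Proj0 S A B = R g \<cdot> f" "r \<cdot> Proj1 S A B = R f \<cdot> g"
proof -
  have "f \<in> hom C (Dom C f) A" "g \<in> hom C (Dom C f) B" "Dom C f \<in> Obj C"
    using assms by (auto simp: hom_iff)
  then have "\<exists>h. h \<in> hom C (Dom C f) (Prod S A B) \<and>
      h \<cdot> Proj0 S A B = R g \<cdot> f \<and> h \<cdot> Proj1 S A B = R f \<cdot> g"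
    using Prod_restriction_product[OF assms(1,2)] unfolding is_restriction_product_def by blast
  then show thesis
    using that by (auto simp: hom_iff)
qed

lemma Proj_jointly_monic:
  assumes "A \<in> Obj C" "B \<in> Obj C" "x \<in> Arr C" "y \<in> Arr C" "Dom C x = Dom C y"
    "Cod C x = Prod S A B" "Cod C y = Prod S A B"
    "x \<cdot> Proj0 S A B = y \<cdot> Proj0 S A B" "x \<cdot> Proj1 S A B = y \<cdot> Proj1 S A B"
  shows "x = y"
proof -
  let ?f = "x \<cdot> Proj0 S A B" and ?g = "x \<cdot> Proj1 S A B"
  have "?f \<in> hom C (Dom C x) A" "?g \<in> hom C (Dom C x) B" "Dom C x \<in> Obj C"
    using assms(1-7) by (auto simp: hom_iff)
  then have ex: "\<exists>!h. h \<in> hom C (Dom C x) (Prod S A B) \<and>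
      h \<cdot> Proj0 S A B = R ?g \<cdot> ?f \<and> h \<cdot> Proj1 S A B = R ?f \<cdot> ?g"
    using Prod_restriction_product[OF assms(1,2)] unfolding is_restriction_product_def by blast
  have "R ?f = R x" "R ?g = R x"
    using assms(1-7) by (simp_all add: R_Comp_total)
  then have "R ?g \<cdot> ?f = ?f" "R ?f \<cdot> ?g = ?g"
    using assms(1-7) by simp_all
  moreover have "x \<in> hom C (Dom C x) (Prod S A B)" "y \<in> hom C (Dom C x) (Prod S A B)"
    using assms(3-7) by (auto simp: hom_iff)
  ultimately show ?thesis
    using ex assms(8,9) by metis
qed

text \<open>The partial projections of a coproduct, each undefined on the other summand.\<close>
abbreviation quasi0 :: "'o \<Rightarrow> 'o \<Rightarrow> 'm" where
  "quasi0 A B \<equiv> copair C S (Idn C A) (Z B A)"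

abbreviation quasi1 :: "'o \<Rightarrow> 'o \<Rightarrow> 'm" where
  "quasi1 A B \<equiv> copair C S (Z A B) (Idn C B)"

lemma copair_Z [simp]:
  "\<lbrakk>A \<in> Obj C; B \<in> Obj C; X \<in> Obj C\<rbrakk> \<Longrightarrow> copair C S (Z A X) (Z B X) = Z (Coprod S A B) X"
  by (rule copair_unique[where A = A and B = B]) simp_all

lemma Inj_guard:
  assumes "A \<in> Obj C" "B \<in> Obj C" "x \<in> Arr C" "y \<in> Arr C" "Dom C x = A" "Dom C y = B"
    "Cod C y = Cod C x"
  shows "Inj0 S A B \<cdot> R (copair C S x y) = R x \<cdot> Inj0 S A B"
    "Inj1 S A B \<cdot> R (copair C S x y) = R y \<cdot> Inj1 S A B"
    "Inj0 S A B \<cdot> N (copair C S x y) = N x \<cdot> Inj0 S A B"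
    "Inj1 S A B \<cdot> N (copair C S x y) = N y \<cdot> Inj1 S A B"
  using assms by (simp_all add: Comp_R Comp_N_Arr)

lemma Inj_guard_Comp:
  assumes "A \<in> Obj C" "B \<in> Obj C" "x \<in> Arr C" "y \<in> Arr C" "Dom C x = A" "Dom C y = B"
    "Cod C y = Cod C x" "h \<in> Arr C" "Dom C h = Coprod S A B"
  shows "Inj0 S A B \<cdot> (R (copair C S x y) \<cdot> h) = R x \<cdot> (Inj0 S A B \<cdot> h)"
    "Inj1 S A B \<cdot> (R (copair C S x y) \<cdot> h) = R y \<cdot> (Inj1 S A B \<cdot> h)"
    "Inj0 S A B \<cdot> (N (copair C S x y) \<cdot> h) = N x \<cdot> (Inj0 S A B \<cdot> h)"
    "Inj1 S A B \<cdot> (N (copair C S x y) \<cdot> h) = N y \<cdot> (Inj1 S A B \<cdot> h)"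
proof -
  have assoc: "i \<cdot> (r \<cdot> h) = (i \<cdot> r) \<cdot> h"
    if "i \<in> Arr C" "r \<in> Arr C" "Cod C i = Dom C r" "Cod C r = Coprod S A B" for i r
    using that assms by simp
  show "Inj0 S A B \<cdot> (R (copair C S x y) \<cdot> h) = R x \<cdot> (Inj0 S A B \<cdot> h)"
    "Inj1 S A B \<cdot> (R (copair C S x y) \<cdot> h) = R y \<cdot> (Inj1 S A B \<cdot> h)"
    "Inj0 S A B \<cdot> (N (copair C S x y) \<cdot> h) = N x \<cdot> (Inj0 S A B \<cdot> h)"
    "Inj1 S A B \<cdot> (N (copair C S x y) \<cdot> h) = N y \<cdot> (Inj1 S A B \<cdot> h)"
    using assms by (subst assoc; simp add: Inj_guard)+
qed

text \<open>
  The domains of the two partial projections are the two summands, and each is the complement of the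
  other.
\<close>
lemma quasi_guard:
  assumes "A \<in> Obj C" "B \<in> Obj C"
  shows "R (quasi0 A B) = quasi0 A B \<cdot> Inj0 S A B" "N (quasi0 A B) = quasi1 A B \<cdot> Inj1 S A B"
    "R (quasi1 A B) = quasi1 A B \<cdot> Inj1 S A B" "N (quasi1 A B) = quasi0 A B \<cdot> Inj0 S A B"
  by (rule copair_eqI[where A = A and B = B]; use assms in \<open>simp add: Inj_guard\<close>)+

text \<open>
  A map \<open>h\<close> into \<open>A \<oplus> B\<close> splits its domain into the part sent to \<open>A\<close> and the part sent to \<open>B\<close>, and on
  each part it is one of the partial projections followed by an injection.
\<close>
lemma quasi_jointly_monic:
  assumes "A \<in> Obj C" "B \<in> Obj C" "h \<in> Arr C" "k \<in> Arr C" "Dom C h = Dom C k"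
    "Cod C h = Coprod S A B" "Cod C k = Coprod S A B"
    "h \<cdot> quasi0 A B = k \<cdot> quasi0 A B" "h \<cdot> quasi1 A B = k \<cdot> quasi1 A B"
  shows "h = k"
proof (rule separation_Arr[of "h \<cdot> quasi0 A B"])
  have split: "R (x \<cdot> quasi0 A B) \<cdot> x = (x \<cdot> quasi0 A B) \<cdot> Inj0 S A B"
    "N (x \<cdot> quasi0 A B) \<cdot> x = (x \<cdot> quasi1 A B) \<cdot> Inj1 S A B"
    if "x \<in> Arr C" "Cod C x = Coprod S A B" for x
    using Comp_R[of x "quasi0 A B"] Comp_N_Arr[of x "quasi0 A B"] that assms(1,2)
    by (simp_all add: quasi_guard del: copair_Comp)
  show "R (h \<cdot> quasi0 A B) \<cdot> h = R (h \<cdot> quasi0 A B) \<cdot> k"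
    using split(1)[of h] split(1)[of k] assms by metis
  show "N (h \<cdot> quasi0 A B) \<cdot> h = N (h \<cdot> quasi0 A B) \<cdot> k"
    using split(2)[of h] split(2)[of k] assms by metis
qed (use assms(1-7) in simp_all)

text \<open>
  All three partial projections of \<open>A \<oplus> B \<oplus> A \<times> B\<close> can be expressed by \<open>p\<^sub>0\<close> and \<open>p\<^sub>1\<close>: a value lies in
  \<open>A\<close> if \<open>p\<^sub>0\<close> is defined and \<open>p\<^sub>1\<close> is not, in \<open>B\<close> if it is the other way round, and in \<open>A \<times> B\<close> if both
  are defined. Since guards are stable under precomposition, the composites of \<open>h\<close> with \<open>p\<^sub>0\<close> and
  \<open>p\<^sub>1\<close> determine its composites with the partial projections, and therefore \<open>h\<close>.
\<close>
lemma classical_product_unique: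
  assumes "A \<in> Obj C" "B \<in> Obj C" "h \<in> Arr C" "k \<in> Arr C" "Dom C h = Dom C k"
    "Cod C h = cprod S A B" "Cod C k = cprod S A B"
    "h \<cdot> cproj0 C S Z A B = k \<cdot> cproj0 C S Z A B" "h \<cdot> cproj1 C S Z A B = k \<cdot> cproj1 C S Z A B"
  shows "h = k"
proof -
  let ?Q = "Coprod S A B" and ?P = "Prod S A B"
  define p0 where "p0 = copair C S (quasi0 A B) (Proj0 S A B)"
  define p1 where "p1 = copair C S (quasi1 A B) (Proj1 S A B)"
  let ?q0 = "quasi0 ?Q ?P" and ?q1 = "quasi1 ?Q ?P"
  have p: "p0 \<in> Arr C" "p1 \<in> Arr C" "Dom C p0 = Coprod S ?Q ?P" "Dom C p1 = Coprod S ?Q ?P"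
    "Cod C p0 = A" "Cod C p1 = B"
    using assms(1,2) by (simp_all add: p0_def p1_def)
  have eq: "h \<cdot> p0 = k \<cdot> p0" "h \<cdot> p1 = k \<cdot> p1"
    and hk: "Cod C h = Coprod S ?Q ?P" "Cod C k = Coprod S ?Q ?P"
    using assms by (simp_all add: p0_def p1_def cproj0_def cproj1_def cprod_def)
  have 0: "N p1 \<cdot> p0 = ?q0 \<cdot> quasi0 A B"
    by (rule copair_eqI[where A = ?Q and B = ?P])
       (use assms(1,2) in \<open>simp_all add: p0_def p1_def Inj_guard_Comp quasi_guard\<close>)
  have 1: "N p0 \<cdot> p1 = ?q0 \<cdot> quasi1 A B"
    by (rule copair_eqI[where A = ?Q and B = ?P])
       (use assms(1,2) in \<open>simp_all add: p0_def p1_def Inj_guard_Comp quasi_guard\<close>)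
  have 2: "R p1 \<cdot> p0 = ?q1 \<cdot> Proj0 S A B"
    by (rule copair_eqI[where A = ?Q and B = ?P])
       (use assms(1,2) in \<open>simp_all add: p0_def p1_def Inj_guard_Comp quasi_guard\<close>)
  have 3: "R p0 \<cdot> p1 = ?q1 \<cdot> Proj1 S A B"
    by (rule copair_eqI[where A = ?Q and B = ?P])
       (use assms(1,2) in \<open>simp_all add: p0_def p1_def Inj_guard_Comp quasi_guard\<close>)
  have guard: "x \<cdot> (N p \<cdot> p') = N (x \<cdot> p) \<cdot> (x \<cdot> p')" "x \<cdot> (R p \<cdot> p') = R (x \<cdot> p) \<cdot> (x \<cdot> p')"
    if "x \<in> Arr C" "p \<in> Arr C" "p' \<in> Arr C" "Cod C x = Dom C p" "Dom C p' = Dom C p" for x p p'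
    using that Comp_N_Arr[of x p] Comp_R[of x p] by (simp_all flip: Comp_assoc_Arr)
  have "h \<cdot> (N p1 \<cdot> p0) = k \<cdot> (N p1 \<cdot> p0)" "h \<cdot> (N p0 \<cdot> p1) = k \<cdot> (N p0 \<cdot> p1)"
    "h \<cdot> (R p1 \<cdot> p0) = k \<cdot> (R p1 \<cdot> p0)" "h \<cdot> (R p0 \<cdot> p1) = k \<cdot> (R p0 \<cdot> p1)"
    using eq hk p assms(3,4) by (simp_all add: guard)
  then have comps: "(h \<cdot> ?q0) \<cdot> quasi0 A B = (k \<cdot> ?q0) \<cdot> quasi0 A B"
    "(h \<cdot> ?q0) \<cdot> quasi1 A B = (k \<cdot> ?q0) \<cdot> quasi1 A B"
    "(h \<cdot> ?q1) \<cdot> Proj0 S A B = (k \<cdot> ?q1) \<cdot> Proj0 S A B"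
    "(h \<cdot> ?q1) \<cdot> Proj1 S A B = (k \<cdot> ?q1) \<cdot> Proj1 S A B"
    using assms(1-4) hk unfolding 0 1 2 3 by (simp_all del: copair_Comp)
  have "h \<cdot> ?q0 = k \<cdot> ?q0"
    by (rule quasi_jointly_monic[of A B]) (use comps(1,2) assms(1-5) hk in \<open>simp_all del: Comp_assoc_Arr\<close>)
  moreover have "h \<cdot> ?q1 = k \<cdot> ?q1"
    by (rule Proj_jointly_monic[of A B]) (use comps(3,4) assms(1-5) hk in \<open>simp_all del: Comp_assoc_Arr\<close>)
  ultimately show ?thesis
    by (rule quasi_jointly_monic[of ?Q ?P, rotated 7]) (use assms(1-5) hk in simp_all)
qed

text \<open>
  The map \<open>m\<close> induced by \<open>f\<close> and \<open>g\<close> is glued from three parts: the restriction pairing \<open>r\<close> where both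
  are defined, and otherwise the map \<open>l\<close>, which is \<open>g\<close> (followed by an injection) where only \<open>g\<close> is
  defined and \<open>f\<close> where \<open>g\<close> is undefined. The projections of \<open>m\<close> are then compared with \<open>f\<close> and \<open>g\<close> part
  by part.
\<close>
lemma classical_product_exists:
  assumes "A \<in> Obj C" "B \<in> Obj C" "f \<in> Arr C" "g \<in> Arr C" "Dom C f = X" "Dom C g = X"
    "Cod C f = A" "Cod C g = B"
  obtains m where "m \<in> Arr C" "Dom C m = X" "Cod C m = cprod S A B"
    "m \<cdot> cproj0 C S Z A B = f" "m \<cdot> cproj1 C S Z A B = g"
proof -
  let ?Q = "Coprod S A B" and ?P = "Prod S A B"
  have X: "X \<in> Obj C" using assms by auto
  obtain r where r: "r \<in> Arr C" "Dom C r = X" "Cod C r = ?P"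
    "r \<cdot> Proj0 S A B = R g \<cdot> f" "r \<cdot> Proj1 S A B = R f \<cdot> g"
    by (rule restriction_pair[of A B f g]) (use assms in simp_all)
  obtain l where l: "l \<in> Arr C" "Dom C l = X" "Cod C l = ?Q"
    "R g \<cdot> l = R g \<cdot> (N f \<cdot> (g \<cdot> Inj1 S A B))" "N g \<cdot> l = N g \<cdot> (f \<cdot> Inj0 S A B)"
    by (rule glue[of g "N f \<cdot> (g \<cdot> Inj1 S A B)" "f \<cdot> Inj0 S A B" ?Q]) (use assms in simp_all)
  obtain m where m: "m \<in> Arr C" "Dom C m = X" "Cod C m = Coprod S ?Q ?P"
    "R r \<cdot> m = R r \<cdot> (r \<cdot> Inj1 S ?Q ?P)" "N r \<cdot> m = N r \<cdot> (l \<cdot> Inj0 S ?Q ?P)"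
    by (rule glue[of r "r \<cdot> Inj1 S ?Q ?P" "l \<cdot> Inj0 S ?Q ?P" "Coprod S ?Q ?P"])
       (use assms r l in simp_all)
  have assoc: "e \<cdot> (n \<cdot> p) = (e \<cdot> n) \<cdot> p"
    if "e \<in> Arr C" "n \<in> Arr C" "p \<in> Arr C" "Cod C e = Dom C n" "Cod C n = Dom C p" for e n p
    using that by simp
  have lq: "R g \<cdot> (l \<cdot> quasi0 A B) = Z X A" "N g \<cdot> (l \<cdot> quasi0 A B) = N g \<cdot> f"
    "R g \<cdot> (l \<cdot> quasi1 A B) = N f \<cdot> g" "N g \<cdot> (l \<cdot> quasi1 A B) = Z X B"
  proof -
    show "R g \<cdot> (l \<cdot> quasi0 A B) = Z X A" "N g \<cdot> (l \<cdot> quasi0 A B) = N g \<cdot> f"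
     "N g \<cdot> (l \<cdot> quasi1 A B) = Z X B"
      using assms l X by (subst assoc; simp)+
    have "R g \<cdot> (l \<cdot> quasi1 A B) = R g \<cdot> (N f \<cdot> g)"
      using assms l X by (subst assoc) simp_all
    then show "R g \<cdot> (l \<cdot> quasi1 A B) = N f \<cdot> g"
      using assms by (simp add: guard_left_commute(2)[of g f])
  qed
  have mp: "R r \<cdot> (m \<cdot> cproj0 C S Z A B) = r \<cdot> Proj0 S A B"
    "N r \<cdot> (m \<cdot> cproj0 C S Z A B) = N r \<cdot> (l \<cdot> quasi0 A B)"
    "R r \<cdot> (m \<cdot> cproj1 C S Z A B) = r \<cdot> Proj1 S A B"
    "N r \<cdot> (m \<cdot> cproj1 C S Z A B) = N r \<cdot> (l \<cdot> quasi1 A B)"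
    unfolding cproj0_def cproj1_def
    using assms(1,2) m r(1-3) l(1-3) by (subst assoc; simp)+
  \<comment> \<open>The domain of \<open>r\<close> is the intersection of those of \<open>f\<close> and \<open>g\<close>.\<close>
  have rf: "R r \<cdot> x = R g \<cdot> (R f \<cdot> x)" if "x \<in> Arr C" "Dom C x = X" for x
  proof -
    have "R r = R (r \<cdot> Proj0 S A B)"
      using r(1-3) assms(1,2) by (simp add: R_Comp_total)
    then show ?thesis
      using that assms by (simp add: r(4) R_guarded)
  qed
  have Nr: "N r \<cdot> (R g \<cdot> f) = Z X A" "N r \<cdot> (R f \<cdot> g) = Z X B"
    using guard_disjoint(5)[of r] r assms X
    unfolding r(4)[symmetric] r(5)[symmetric] by (simp_all flip: Comp_assoc_Arr)
  have mf: "m \<cdot> cproj0 C S Z A B = f"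
  proof (rule separation_Arr[of r])
    show "R r \<cdot> (m \<cdot> cproj0 C S Z A B) = R r \<cdot> f"
      using assms r by (simp add: mp rf)
    have "N r \<cdot> (l \<cdot> quasi0 A B) = N r \<cdot> f"
    proof (rule separation_Arr[of g])
      show "R g \<cdot> (N r \<cdot> (l \<cdot> quasi0 A B)) = R g \<cdot> (N r \<cdot> f)"
        using assms r(1,2) l(1-3) X Nr(1) lq(1)
        by (simp add: guard_left_commute(2)[of g r] del: copair_Comp)
      show "N g \<cdot> (N r \<cdot> (l \<cdot> quasi0 A B)) = N g \<cdot> (N r \<cdot> f)"
        using assms r(1,2) l(1-3) X lq(2)
        by (simp add: guard_left_commute(3)[of g r] del: copair_Comp)
    qed (use assms r(1-3) l(1-3) in simp_all)
    then show "N r \<cdot> (m \<cdot> cproj0 C S Z A B) = N r \<cdot> f"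
      by (simp add: mp)
  qed (use assms m(1-3) r(1-3) in \<open>simp_all add: cproj0_def\<close>)
  have mg: "m \<cdot> cproj1 C S Z A B = g"
  proof (rule separation_Arr[of r])
    show "R r \<cdot> (m \<cdot> cproj1 C S Z A B) = R r \<cdot> g"
      using assms r by (simp add: mp rf guard_left_commute(1)[of g f])
    have fg: "N r \<cdot> (N f \<cdot> g) = N r \<cdot> g"
    proof (rule separation_Arr[of f])
      show "R f \<cdot> (N r \<cdot> (N f \<cdot> g)) = R f \<cdot> (N r \<cdot> g)"
        using assms r(1,2) X Nr(2) by (simp add: guard_left_commute(2)[of f r])
      show "N f \<cdot> (N r \<cdot> (N f \<cdot> g)) = N f \<cdot> (N r \<cdot> g)"
        using assms r(1,2) X by (simp add: guard_left_commute(3)[of f r])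
    qed (use assms r(1-3) in simp_all)
    have "N r \<cdot> (l \<cdot> quasi1 A B) = N r \<cdot> g"
    proof (rule separation_Arr[of g])
      show "R g \<cdot> (N r \<cdot> (l \<cdot> quasi1 A B)) = R g \<cdot> (N r \<cdot> g)"
        using assms r(1,2) l(1-3) X fg lq(3)
        by (simp add: guard_left_commute(2)[of g r] del: copair_Comp)
      show "N g \<cdot> (N r \<cdot> (l \<cdot> quasi1 A B)) = N g \<cdot> (N r \<cdot> g)"
        using assms r(1,2) l(1-3) X lq(4)
        by (simp add: guard_left_commute(3)[of g r] del: copair_Comp)
    qed (use assms r(1-3) l(1-3) in simp_all)
    then show "N r \<cdot> (m \<cdot> cproj1 C S Z A B) = N r \<cdot> g"
      by (simp add: mp)
  qed (use assms m(1-3) r(1-3) in \<open>simp_all add: cproj1_def\<close>)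
  show thesis
    using that[of m] m(1-3) mf mg by (simp add: cprod_def)
qed

lemma classical_products: "has_classical_products C R S"
  unfolding has_classical_products_def
proof (intro conjI exI ballI)
  show "distributive_restriction_category C R S" "restriction_zeroes C R Z"
    by (rule distributive_restriction_category_axioms restriction_zeroes_axioms)+
  fix A B assume AB: "A \<in> Obj C" "B \<in> Obj C"
  show "is_product C A B (cprod S A B) (cproj0 C S Z A B) (cproj1 C S Z A B)"
    unfolding is_product_def
  proof (intro conjI ballI)
    show "cprod S A B \<in> Obj C" "cproj0 C S Z A B \<in> hom C (cprod S A B) A"
      "cproj1 C S Z A B \<in> hom C (cprod S A B) B"
      using AB by (simp_all add: cprod_def cproj0_def cproj1_def hom_iff)
    fix X f g assume "f \<in> hom C X A" "g \<in> hom C X B"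
    then have fg: "f \<in> Arr C" "g \<in> Arr C" "Dom C f = X" "Dom C g = X" "Cod C f = A" "Cod C g = B"
      by (simp_all add: hom_iff)
    obtain m where m: "m \<in> Arr C" "Dom C m = X" "Cod C m = cprod S A B"
      "m \<cdot> cproj0 C S Z A B = f" "m \<cdot> cproj1 C S Z A B = g"
      by (rule classical_product_exists[OF AB fg])
    show "\<exists>!h. h \<in> hom C X (cprod S A B) \<and> h \<cdot> cproj0 C S Z A B = f \<and> h \<cdot> cproj1 C S Z A B = g"
    proof (rule ex1I[of _ m])
      show "m \<in> hom C X (cprod S A B) \<and> m \<cdot> cproj0 C S Z A B = f \<and> m \<cdot> cproj1 C S Z A B = g"
        using m by (simp add: hom_iff)
      show "h = m"
        if "h \<in> hom C X (cprod S A B) \<and> h \<cdot> cproj0 C S Z A B = f \<and> h \<cdot> cproj1 C S Z A B = g" for h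
        by (rule classical_product_unique[OF AB]) (use that m in \<open>simp_all add: hom_iff\<close>)
    qed
  qed
qed

end

section \<open>Case analysis in a distributive category\<close>

context distributive_category
begin

text \<open>
  For \<open>f : A \<rightarrow> B \<oplus> E\<close>, \<open>u : A \<times> B \<rightarrow> X\<close> and \<open>v : A \<times> E \<rightarrow> X\<close> this is, in terms of elements, the map that
  sends \<open>a\<close> to \<open>u (a, b)\<close> if \<open>f a\<close> is some \<open>b\<close> in \<open>B\<close>, and to \<open>v (a, e)\<close> if \<open>f a\<close> is some \<open>e\<close> in
  \<open>E\<close>. The objects \<open>B\<close> and \<open>E\<close> are arguments since \<open>B \<oplus> E\<close> does not determine them.
\<close>
definition branch :: "'a \<Rightarrow> 'a \<Rightarrow> 'b \<Rightarrow> 'b \<Rightarrow> 'b \<Rightarrow> 'b" where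
  "branch B E f u v = pair C S (Idn C (Dom C f)) f
     \<cdot> inverse_of C (distr C S (pair C S) (Dom C f) B E) \<cdot> copair C S u v"

text \<open>
  The maps \<open>1 \<times> \<iota>\<^sub>0\<close> and \<open>1 \<times> \<iota>\<^sub>1\<close> into \<open>A \<times> (B \<oplus> E)\<close>. Distributivity says that they are the injections
  of a coproduct.
\<close>
abbreviation inl :: "'a \<Rightarrow> 'a \<Rightarrow> 'a \<Rightarrow> 'b" where
  "inl A B E \<equiv> pair C S (Proj0 S A B) (Proj1 S A B \<cdot> Inj0 S B E)"

abbreviation inr :: "'a \<Rightarrow> 'a \<Rightarrow> 'a \<Rightarrow> 'b" where
  "inr A B E \<equiv> pair C S (Proj0 S A E) (Proj1 S A E \<cdot> Inj1 S B E)"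

lemma distr_inverse:
  assumes "A \<in> Obj C" "B \<in> Obj C" "E \<in> Obj C"
  obtains d i where "d = distr C S (pair C S) A B E" "i = inverse_of C d"
    "d = copair C S (inl A B E) (inr A B E)"
    "d \<in> Arr C" "Dom C d = Coprod S (Prod S A B) (Prod S A E)" "Cod C d = Prod S A (Coprod S B E)"
    "i \<in> Arr C" "Dom C i = Prod S A (Coprod S B E)" "Cod C i = Coprod S (Prod S A B) (Prod S A E)"
    "d \<cdot> i = Idn C (Coprod S (Prod S A B) (Prod S A E))" "i \<cdot> d = Idn C (Prod S A (Coprod S B E))"
proof -
  have "is_inverse C (distr C S (pair C S) A B E) (inverse_of C (distr C S (pair C S) A B E))"
    using assms by (intro is_inverse_inverse_of distr_iso)
  then show thesis
    using assms by (intro that[OF refl refl]) (simp_all add: is_inverse_def hom_iff distr_def id_times_def)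
qed

lemma branch_Arr [simp]:
  assumes "B \<in> Obj C" "E \<in> Obj C" "f \<in> Arr C" "Cod C f = Coprod S B E"
    "u \<in> Arr C" "Dom C u = Prod S (Dom C f) B" "v \<in> Arr C" "Dom C v = Prod S (Dom C f) E"
    "Cod C v = Cod C u"
  shows "branch B E f u v \<in> Arr C" "Dom C (branch B E f u v) = Dom C f"
    "Cod C (branch B E f u v) = Cod C u"
  by (rule distr_inverse[of "Dom C f" B E]; use assms in \<open>simp add: branch_def\<close>)+

text \<open>
  The fundamental law: to substitute \<open>f a\<close> for \<open>s\<close> in \<open>z (a, s)\<close> is to branch on \<open>f\<close>, with \<open>s\<close>
  replaced by \<open>\<iota>\<^sub>0 b\<close> in one branch and by \<open>\<iota>\<^sub>1 e\<close> in the other. Together with the lemma after it, it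
  reduces every equation about \<open>branch\<close> to one between ordinary composites.
\<close>
lemma branch_substitute:
  assumes "B \<in> Obj C" "E \<in> Obj C" "f \<in> Arr C" "Cod C f = Coprod S B E" "Dom C f = A"
    "z \<in> Arr C" "Dom C z = Prod S A (Coprod S B E)" "inl A B E \<cdot> z = u" "inr A B E \<cdot> z = v"
  shows "branch B E f u v = pair C S (Idn C A) f \<cdot> z"
proof -
  have A: "A \<in> Obj C" using assms by auto
  obtain d i where d: "d = distr C S (pair C S) A B E" "i = inverse_of C d"
    "d = copair C S (inl A B E) (inr A B E)"
    "d \<in> Arr C" "Dom C d = Coprod S (Prod S A B) (Prod S A E)" "Cod C d = Prod S A (Coprod S B E)"
    "i \<in> Arr C" "Dom C i = Prod S A (Coprod S B E)" "Cod C i = Coprod S (Prod S A B) (Prod S A E)"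
    "d \<cdot> i = Idn C (Coprod S (Prod S A B) (Prod S A E))" "i \<cdot> d = Idn C (Prod S A (Coprod S B E))"
    by (rule distr_inverse[OF A assms(1,2)])
  have "copair C S u v = d \<cdot> z"
    unfolding d(3) using assms A by (subst copair_Comp) simp_all
  then have "branch B E f u v = pair C S (Idn C A) f \<cdot> i \<cdot> (d \<cdot> z)"
    using d(1,2) assms by (simp add: branch_def)
  also have "\<dots> = pair C S (Idn C A) f \<cdot> ((i \<cdot> d) \<cdot> z)"
    using d(4-9) assms A by (simp del: Comp_pair_Comp)
  finally show ?thesis
    using d assms by simp
qed

text \<open>
  Every pair of branches comes from a single map \<open>w\<close> by substitution, so that
  the previous law applies to an arbitrary case analysis.
\<close>
lemma branch_generic:
  assumes "A \<in> Obj C" "B \<in> Obj C" "E \<in> Obj C"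
    "u \<in> Arr C" "Dom C u = Prod S A B" "v \<in> Arr C" "Dom C v = Prod S A E"
    "Cod C u = X" "Cod C v = X"
  obtains w where "w \<in> Arr C" "Dom C w = Prod S A (Coprod S B E)" "Cod C w = X"
    "u = inl A B E \<cdot> w" "v = inr A B E \<cdot> w"
proof -
  obtain d i where d: "d = distr C S (pair C S) A B E" "i = inverse_of C d"
    "d = copair C S (inl A B E) (inr A B E)"
    "d \<in> Arr C" "Dom C d = Coprod S (Prod S A B) (Prod S A E)" "Cod C d = Prod S A (Coprod S B E)"
    "i \<in> Arr C" "Dom C i = Prod S A (Coprod S B E)" "Cod C i = Coprod S (Prod S A B) (Prod S A E)"
    "d \<cdot> i = Idn C (Coprod S (Prod S A B) (Prod S A E))" "i \<cdot> d = Idn C (Prod S A (Coprod S B E))"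
    by (rule distr_inverse[OF assms(1-3)])
  let ?w = "i \<cdot> copair C S u v"
  have w: "?w \<in> Arr C" "Dom C ?w = Prod S A (Coprod S B E)" "Cod C ?w = X"
    using d assms by simp_all
  have "d \<cdot> ?w = (d \<cdot> i) \<cdot> copair C S u v"
    using d(4-9) assms by (subst Comp_assoc_Arr) simp_all
  also have "\<dots> = copair C S u v"
    unfolding d(10) using assms by simp
  finally have "copair C S (inl A B E \<cdot> ?w) (inr A B E \<cdot> ?w) = copair C S u v"
    unfolding d(3) using w assms by (subst (asm) copair_Comp) simp_all
  then have "Inj0 S (Prod S A B) (Prod S A E) \<cdot> copair C S (inl A B E \<cdot> ?w) (inr A B E \<cdot> ?w)
      = Inj0 S (Prod S A B) (Prod S A E) \<cdot> copair C S u v"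
    "Inj1 S (Prod S A B) (Prod S A E) \<cdot> copair C S (inl A B E \<cdot> ?w) (inr A B E \<cdot> ?w)
      = Inj1 S (Prod S A B) (Prod S A E) \<cdot> copair C S u v"
    by simp_all
  then have "inl A B E \<cdot> ?w = u" "inr A B E \<cdot> ?w = v"
    using w assms by simp_all
  with w show thesis
    using that[of ?w] by simp
qed

lemma Comp_branch:
  assumes "B \<in> Obj C" "E \<in> Obj C" "f \<in> Arr C" "Cod C f = Coprod S B E" "Dom C f = A"
    "u \<in> Arr C" "Dom C u = Prod S A B" "v \<in> Arr C" "Dom C v = Prod S A E"
    "Cod C v = Cod C u" "g \<in> Arr C" "Dom C g = Y" "Cod C g = A"
  shows "g \<cdot> branch B E f u v = branch B E (g \<cdot> f)
     (pair C S (Proj0 S Y B \<cdot> g) (Proj1 S Y B) \<cdot> u)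
     (pair C S (Proj0 S Y E \<cdot> g) (Proj1 S Y E) \<cdot> v)"
proof -
  have obj: "A \<in> Obj C" "Y \<in> Obj C" using assms by auto
  obtain X where X: "Cod C u = X" "Cod C v = X" using assms by simp
  obtain w where w: "w \<in> Arr C" "Dom C w = Prod S A (Coprod S B E)" "Cod C w = X"
    "u = inl A B E \<cdot> w" "v = inr A B E \<cdot> w"
    by (rule branch_generic[of A B E u v X]) (use assms X obj in simp_all)
  have "branch B E f u v = pair C S (Idn C A) f \<cdot> w"
    by (rule branch_substitute) (use assms X w in simp_all)
  moreover have "branch B E (g \<cdot> f)
     (pair C S (Proj0 S Y B \<cdot> g) (Proj1 S Y B) \<cdot> u)
     (pair C S (Proj0 S Y E \<cdot> g) (Proj1 S Y E) \<cdot> v)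
     = pair C S (Idn C Y) (g \<cdot> f)
        \<cdot> (pair C S (Proj0 S Y (Coprod S B E) \<cdot> g) (Proj1 S Y (Coprod S B E)) \<cdot> w)"
    by (rule branch_substitute) (use assms X w(1-3) obj in \<open>simp_all add: w(4,5)\<close>)
  ultimately show ?thesis
    using assms X w(1-3) obj by simp
qed

lemma branch_Inj0:
  assumes "B \<in> Obj C" "E \<in> Obj C" "k \<in> Arr C" "Cod C k = B" "Dom C k = A"
    "u \<in> Arr C" "Dom C u = Prod S A B" "v \<in> Arr C" "Dom C v = Prod S A E" "Cod C v = Cod C u"
  shows "branch B E (k \<cdot> Inj0 S B E) u v = pair C S (Idn C A) k \<cdot> u"
proof -
  have obj: "A \<in> Obj C" using assms by auto
  obtain X where X: "Cod C u = X" "Cod C v = X" using assms by simp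
  obtain w where w: "w \<in> Arr C" "Dom C w = Prod S A (Coprod S B E)" "Cod C w = X"
    "u = inl A B E \<cdot> w" "v = inr A B E \<cdot> w"
    by (rule branch_generic[of A B E u v X]) (use assms X obj in simp_all)
  have "branch B E (k \<cdot> Inj0 S B E) u v = pair C S (Idn C A) (k \<cdot> Inj0 S B E) \<cdot> w"
    by (rule branch_substitute) (use assms X w in simp_all)
  then show ?thesis
    using assms X w(1-3) obj by (simp add: w(4))
qed

lemma branch_Inj1:
  assumes "B \<in> Obj C" "E \<in> Obj C" "k \<in> Arr C" "Cod C k = E" "Dom C k = A"
    "u \<in> Arr C" "Dom C u = Prod S A B" "v \<in> Arr C" "Dom C v = Prod S A E" "Cod C v = Cod C u"
  shows "branch B E (k \<cdot> Inj1 S B E) u v = pair C S (Idn C A) k \<cdot> v"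
proof -
  have obj: "A \<in> Obj C" using assms by auto
  obtain X where X: "Cod C u = X" "Cod C v = X" using assms by simp
  obtain w where w: "w \<in> Arr C" "Dom C w = Prod S A (Coprod S B E)" "Cod C w = X"
    "u = inl A B E \<cdot> w" "v = inr A B E \<cdot> w"
    by (rule branch_generic[of A B E u v X]) (use assms X obj in simp_all)
  have "branch B E (k \<cdot> Inj1 S B E) u v = pair C S (Idn C A) (k \<cdot> Inj1 S B E) \<cdot> w"
    by (rule branch_substitute) (use assms X w in simp_all)
  then show ?thesis
    using assms X w(1-3) obj by (simp add: w(5))
qed

lemma branch_Comp:
  assumes "B \<in> Obj C" "E \<in> Obj C" "f \<in> Arr C" "Cod C f = Coprod S B E"
    "u \<in> Arr C" "Dom C u = Prod S (Dom C f) B" "v \<in> Arr C" "Dom C v = Prod S (Dom C f) E"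
    "Cod C v = Cod C u" "h \<in> Arr C" "Dom C h = Cod C u"
  shows "branch B E f u v \<cdot> h = branch B E f (u \<cdot> h) (v \<cdot> h)"
  by (rule distr_inverse[of "Dom C f" B E]; use assms in \<open>simp add: branch_def\<close>)

lemma branch_const:
  assumes "B \<in> Obj C" "E \<in> Obj C" "f \<in> Arr C" "Cod C f = Coprod S B E" "Dom C f = A"
    "h \<in> Arr C" "Dom C h = A"
  shows "branch B E f (Proj0 S A B \<cdot> h) (Proj0 S A E \<cdot> h) = h"
proof -
  have A: "A \<in> Obj C" using assms by auto
  have "branch B E f (Proj0 S A B \<cdot> h) (Proj0 S A E \<cdot> h)
      = pair C S (Idn C A) f \<cdot> (Proj0 S A (Coprod S B E) \<cdot> h)"
    by (rule branch_substitute) (use assms A in simp_all)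
  then show ?thesis
    using assms A by simp
qed

lemma branch_const_to_one:
  assumes "B \<in> Obj C" "E \<in> Obj C" "f \<in> Arr C" "Cod C f = Coprod S B E" "Dom C f = A"
    "k \<in> Arr C" "Dom C k = One S"
  shows "branch B E f (to_one C S (Prod S A B) \<cdot> k) (to_one C S (Prod S A E) \<cdot> k)
    = to_one C S A \<cdot> k"
proof -
  have A: "A \<in> Obj C" using assms by auto
  show ?thesis
    using branch_const[of B E f A "to_one C S A \<cdot> k"] assms A by simp
qed

lemma branch_eta:
  assumes "B \<in> Obj C" "E \<in> Obj C" "f \<in> Arr C" "Cod C f = Coprod S B E" "Dom C f = A"
  shows "branch B E f (Proj1 S A B \<cdot> Inj0 S B E) (Proj1 S A E \<cdot> Inj1 S B E) = f"
proof -
  have A: "A \<in> Obj C" using assms by auto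
  have "branch B E f (Proj1 S A B \<cdot> Inj0 S B E) (Proj1 S A E \<cdot> Inj1 S B E)
      = pair C S (Idn C A) f \<cdot> Proj1 S A (Coprod S B E)"
    by (rule branch_substitute) (use assms A in simp_all)
  then show ?thesis
    using assms A by simp
qed

text \<open>
  Case-of-case: branching on a branch moves the outer analysis into the two inner branches. Both
  sides are substitutions into \<open>w\<close>, the map that represents the outer branches.
\<close>
lemma branch_branch:
  assumes "B \<in> Obj C" "E \<in> Obj C" "f \<in> Arr C" "Cod C f = Coprod S B E" "Dom C f = A"
    "u \<in> Arr C" "Dom C u = Prod S A B" "Cod C u = Coprod S B' E'"
    "v \<in> Arr C" "Dom C v = Prod S A E" "Cod C v = Coprod S B' E'"
    "B' \<in> Obj C" "E' \<in> Obj C"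
    "s \<in> Arr C" "Dom C s = Prod S A B'" "t \<in> Arr C" "Dom C t = Prod S A E'" "Cod C t = Cod C s"
  shows "branch B' E' (branch B E f u v) s t = branch B E f
     (branch B' E' u
        (pair C S (Proj0 S (Prod S A B) B' \<cdot> Proj0 S A B) (Proj1 S (Prod S A B) B') \<cdot> s)
        (pair C S (Proj0 S (Prod S A B) E' \<cdot> Proj0 S A B) (Proj1 S (Prod S A B) E') \<cdot> t))
     (branch B' E' v
        (pair C S (Proj0 S (Prod S A E) B' \<cdot> Proj0 S A E) (Proj1 S (Prod S A E) B') \<cdot> s)
        (pair C S (Proj0 S (Prod S A E) E' \<cdot> Proj0 S A E) (Proj1 S (Prod S A E) E') \<cdot> t))"
    (is "_ = branch B E f ?u ?v")
proof -
  have A: "A \<in> Obj C" using assms by auto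
  obtain Y where Y: "Cod C s = Y" "Cod C t = Y" using assms by simp
  obtain w where w: "w \<in> Arr C" "Dom C w = Prod S A (Coprod S B' E')" "Cod C w = Y"
    "s = inl A B' E' \<cdot> w" "t = inr A B' E' \<cdot> w"
    by (rule branch_generic[of A B' E' s t Y]) (use assms Y A in simp_all)
  obtain X where X: "Cod C u = X" "Cod C v = X" using assms by simp
  obtain z where z: "z \<in> Arr C" "Dom C z = Prod S A (Coprod S B E)" "Cod C z = X"
    "u = inl A B E \<cdot> z" "v = inr A B E \<cdot> z"
    by (rule branch_generic[of A B E u v X]) (use assms X A in simp_all)
  have fz: "branch B E f u v = pair C S (Idn C A) f \<cdot> z"
    by (rule branch_substitute) (use assms X z in simp_all)
  have "branch B' E' (branch B E f u v) s t = pair C S (Idn C A) (branch B E f u v) \<cdot> w"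
    by (rule branch_substitute) (use assms X Y w in simp_all)
  moreover have "?u = pair C S (Idn C (Prod S A B)) u
      \<cdot> (pair C S (Proj0 S (Prod S A B) (Coprod S B' E') \<cdot> Proj0 S A B)
          (Proj1 S (Prod S A B) (Coprod S B' E')) \<cdot> w)"
    by (rule branch_substitute) (use assms(1-13) X Y w(1-3) A in \<open>simp_all add: w(4,5)\<close>)
  moreover have "?v = pair C S (Idn C (Prod S A E)) v
      \<cdot> (pair C S (Proj0 S (Prod S A E) (Coprod S B' E') \<cdot> Proj0 S A E)
          (Proj1 S (Prod S A E) (Coprod S B' E')) \<cdot> w)"
    by (rule branch_substitute) (use assms(1-13) X Y w(1-3) A in \<open>simp_all add: w(4,5)\<close>)
  moreover have "branch B E f (pair C S (Proj0 S A B) u \<cdot> w) (pair C S (Proj0 S A E) v \<cdot> w)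
      = pair C S (Idn C A) f \<cdot> (pair C S (Proj0 S A (Coprod S B E)) z \<cdot> w)"
    by (rule branch_substitute) (use assms X Y w(1-3) z(1-3) A in \<open>simp_all add: z(4,5)\<close>)
  ultimately show ?thesis
    using assms X Y w(1-3) z(1-3) A by (simp add: fz)
qed

text \<open>
  A second analysis of \<open>f\<close> inside a branch of the first is already decided. The proof writes the
  right-hand side as the substitution of \<open>f a\<close> for \<open>s\<close> in a map that analyses the variable \<open>s\<close>
  itself, where the outcome is visible once \<open>s\<close> is an injection; naturality turns this
  substitution into the nested analysis.
\<close>
lemma branch_same0:
  assumes "B \<in> Obj C" "E \<in> Obj C" "f \<in> Arr C" "Cod C f = Coprod S B E" "Dom C f = A"
    "u \<in> Arr C" "Dom C u = Prod S A B" "v \<in> Arr C" "Dom C v = Prod S A E" "Cod C v = Cod C u"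
    "t \<in> Arr C" "Dom C t = Prod S A E" "Cod C t = Cod C u"
  shows "branch B E f (Proj0 S A B \<cdot> branch B E f u v) t = branch B E f u t"
proof -
  have A: "A \<in> Obj C" using assms by auto
  obtain X where X: "Cod C u = X" "Cod C v = X" using assms by simp
  obtain z where z: "z \<in> Arr C" "Dom C z = Prod S A (Coprod S B E)" "Cod C z = X"
    "u = inl A B E \<cdot> z" "v = inr A B E \<cdot> z"
    by (rule branch_generic[of A B E u v X]) (use assms X A in simp_all)
  let ?P = "Prod S A (Coprod S B E)"
  let ?z = "branch B E (Proj1 S A (Coprod S B E)) (Proj0 S ?P B \<cdot> z)
    (pair C S (Proj0 S ?P E \<cdot> Proj0 S A (Coprod S B E)) (Proj1 S ?P E) \<cdot> t)"
  have fz: "branch B E f u v = pair C S (Idn C A) f \<cdot> z"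
    by (rule branch_substitute) (use assms X z in simp_all)
  have "branch B E f u t = pair C S (Idn C A) f \<cdot> ?z"
  proof (rule branch_substitute)
    show "inl A B E \<cdot> ?z = u"
      using assms(1-5,11-13) X z(1-3) A by (simp add: z(4) Comp_branch branch_Inj0)
    show "inr A B E \<cdot> ?z = t"
      using assms(1-5,11-13) X z(1-3) A by (simp add: Comp_branch branch_Inj1)
  qed (use assms X z(1-3) A in simp_all)
  also have "\<dots> = branch B E f (Proj0 S A B \<cdot> branch B E f u v) t"
    unfolding fz using assms X z(1-3) A by (simp add: Comp_branch)
  finally show ?thesis ..
qed

lemma branch_same1:
  assumes "B \<in> Obj C" "E \<in> Obj C" "f \<in> Arr C" "Cod C f = Coprod S B E" "Dom C f = A"
    "u \<in> Arr C" "Dom C u = Prod S A B" "v \<in> Arr C" "Dom C v = Prod S A E" "Cod C v = Cod C u"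
    "t \<in> Arr C" "Dom C t = Prod S A B" "Cod C t = Cod C u"
  shows "branch B E f t (Proj0 S A E \<cdot> branch B E f u v) = branch B E f t v"
proof -
  have A: "A \<in> Obj C" using assms by auto
  obtain X where X: "Cod C u = X" "Cod C v = X" using assms by simp
  obtain z where z: "z \<in> Arr C" "Dom C z = Prod S A (Coprod S B E)" "Cod C z = X"
    "u = inl A B E \<cdot> z" "v = inr A B E \<cdot> z"
    by (rule branch_generic[of A B E u v X]) (use assms X A in simp_all)
  let ?P = "Prod S A (Coprod S B E)"
  let ?z = "branch B E (Proj1 S A (Coprod S B E))
    (pair C S (Proj0 S ?P B \<cdot> Proj0 S A (Coprod S B E)) (Proj1 S ?P B) \<cdot> t) (Proj0 S ?P E \<cdot> z)"
  have fz: "branch B E f u v = pair C S (Idn C A) f \<cdot> z"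
    by (rule branch_substitute) (use assms X z in simp_all)
  have "branch B E f t v = pair C S (Idn C A) f \<cdot> ?z"
  proof (rule branch_substitute)
    show "inl A B E \<cdot> ?z = t"
      using assms(1-5,11-13) X z(1-3) A by (simp add: Comp_branch branch_Inj0)
    show "inr A B E \<cdot> ?z = v"
      using assms(1-5,11-13) X z(1-3) A by (simp add: z(5) Comp_branch branch_Inj1)
  qed (use assms X z(1-3) A in simp_all)
  also have "\<dots> = branch B E f t (Proj0 S A E \<cdot> branch B E f u v)"
    unfolding fz using assms X z(1-3) A by (simp add: Comp_branch)
  finally show ?thesis ..
qed

text \<open>
  Two independent analyses whose second alternatives are the same constant can be interchanged.
  This yields both the commutation of restrictions and the first projection of the pairing of
  partial maps.
\<close>
lemma branch_commute:
  assumes "B \<in> Obj C" "E \<in> Obj C" "f \<in> Arr C" "Cod C f = Coprod S B E" "Dom C f = A"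
    "B' \<in> Obj C" "E' \<in> Obj C" "g \<in> Arr C" "Cod C g = Coprod S B' E'" "Dom C g = A"
    "u \<in> Arr C" "Dom C u = Prod S A B" "k \<in> Arr C" "Dom C k = One S" "Cod C k = Cod C u"
  shows "branch B' E' g (Proj0 S A B' \<cdot> branch B E f u (to_one C S (Prod S A E) \<cdot> k))
      (to_one C S (Prod S A E') \<cdot> k)
    = branch B E f
        (branch B' E' (Proj0 S A B \<cdot> g) (Proj0 S (Prod S A B) B' \<cdot> u)
          (to_one C S (Prod S (Prod S A B) E') \<cdot> k))
        (to_one C S (Prod S A E) \<cdot> k)"
    (is "?lhs = ?rhs")
proof -
  have A: "A \<in> Obj C" using assms by auto
  obtain X where X: "Cod C u = X" "Cod C k = X" using assms by simp
  obtain z where z: "z \<in> Arr C" "Dom C z = Prod S A (Coprod S B E)" "Cod C z = X"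
    "u = inl A B E \<cdot> z" "to_one C S (Prod S A E) \<cdot> k = inr A B E \<cdot> z"
    by (rule branch_generic[of A B E u "to_one C S (Prod S A E) \<cdot> k" X])
      (use assms X A in simp_all)
  let ?P = "Prod S A (Coprod S B E)"
  let ?z = "branch B' E' (Proj0 S A (Coprod S B E) \<cdot> g) (Proj0 S ?P B' \<cdot> z)
    (to_one C S (Prod S ?P E') \<cdot> k)"
  have fz: "branch B E f u (to_one C S (Prod S A E) \<cdot> k) = pair C S (Idn C A) f \<cdot> z"
    by (rule branch_substitute) (use assms X z in simp_all)
  have "?rhs = pair C S (Idn C A) f \<cdot> ?z"
  proof (rule branch_substitute)
    show "inl A B E \<cdot> ?z = branch B' E' (Proj0 S A B \<cdot> g) (Proj0 S (Prod S A B) B' \<cdot> u)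
          (to_one C S (Prod S (Prod S A B) E') \<cdot> k)"
      using assms(1-10,13-14) X z(1-3) A by (simp add: z(4) Comp_branch)
    have "inr A B E \<cdot> ?z = branch B' E' (Proj0 S A E \<cdot> g)
        (Proj0 S (Prod S A E) B' \<cdot> (inr A B E \<cdot> z)) (to_one C S (Prod S (Prod S A E) E') \<cdot> k)"
      using assms X z(1-3) A by (simp add: Comp_branch)
    also have "\<dots> = to_one C S (Prod S A E) \<cdot> k"
      unfolding z(5)[symmetric] using assms A by (simp add: branch_const_to_one)
    finally show "inr A B E \<cdot> ?z = to_one C S (Prod S A E) \<cdot> k" .
  qed (use assms X z(1-3) A in simp_all)
  also have "\<dots> = ?lhs"
    unfolding fz using assms X z(1-3) A by (simp add: Comp_branch)
  finally show ?thesis ..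
qed

section \<open>Partial maps as Kleisli maps\<close>

abbreviation K where "K \<equiv> kleisli C S"
abbreviation KR where "KR \<equiv> kleisli_rst C S"
abbreviation KS where "KS \<equiv> kleisli_bicart C S"
abbreviation KZ where "KZ \<equiv> kleisli_zero C S"

abbreviation undef :: "'a \<Rightarrow> 'a \<Rightarrow> 'b" where
  "undef A B \<equiv> to_one C S A \<cdot> Inj1 S B (One S)"

lemma kleisli_simps [simp]:
  "Obj K = Obj C"
  "(A, f, B) \<in> Arr K \<longleftrightarrow>
     A \<in> Obj C \<and> B \<in> Obj C \<and> f \<in> Arr C \<and> Dom C f = A \<and> Cod C f = Coprod S B (One S)"
  "Dom K (A, f, B) = A" "Cod K (A, f, B) = B"
  "Idn K A = (A, Inj0 S A (One S), A)"
  "(A, f, B) \<cdot>\<^bsub>K\<^esub> (B', g, E) = (A, f \<cdot> copair C S g (Inj1 S E (One S)), E)"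
  by (simp_all add: kleisli_def hom_iff)

lemma kleisli_homE:
  assumes "x \<in> hom K A B"
  obtains f where "x = (A, f, B)" "A \<in> Obj C" "B \<in> Obj C" "f \<in> Arr C" "Dom C f = A"
    "Cod C f = Coprod S B (One S)"
  using assms by (cases x) (auto simp: hom_iff)

lemma Proj1_One: "A \<in> Obj C \<Longrightarrow> Proj1 S A (One S) = to_one C S (Prod S A (One S))"
  using to_one_unique[of "Proj1 S A (One S)"] by simp

text \<open>
  The restriction of \<open>f\<close> is the case analysis that returns its argument where \<open>f\<close> is defined and is
  undefined elsewhere.
\<close>
lemma kleisli_rst_eq [simp]:
  assumes "f \<in> Arr C" "Dom C f = A" "A \<in> Obj C"
  shows "KR (A, f, B) = (A, branch B (One S) f (Proj0 S A B \<cdot> Inj0 S A (One S)) (undef (Prod S A (One S)) A), A)"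
  using assms by (simp add: kleisli_rst_def branch_def Proj1_One)

text \<open>
  The restriction idempotent complementary to the restriction of \<open>f\<close>: exchanging the two outcomes
  gives the identity where \<open>f\<close> is undefined. That this is possible is what makes the category of
  partial maps classical.
\<close>
definition kleisli_corst :: "'a \<times> 'b \<times> 'a \<Rightarrow> 'a \<times> 'b \<times> 'a" where
  "kleisli_corst = (\<lambda>(A, f, B). (A, branch B (One S) f (undef (Prod S A B) A)
     (Proj0 S A (One S) \<cdot> Inj0 S A (One S)), A))"

lemma kleisli_corst_eq [simp]:
  "kleisli_corst (A, f, B) = (A, branch B (One S) f (undef (Prod S A B) A)
     (Proj0 S A (One S) \<cdot> Inj0 S A (One S)), A)"
  by (simp add: kleisli_corst_def)

lemma kleisli_category: "category K"
proof
  fix f assume "f \<in> Arr K"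
  then show "Dom K f \<in> Obj K" "Cod K f \<in> Obj K"
    by (cases f; simp)+
next
  fix A assume "A \<in> Obj K"
  then show "Idn K A \<in> hom K A A"
    by (simp add: hom_iff)
next
  fix f g A B E assume "f \<in> hom K A B" "g \<in> hom K B E"
  then show "f \<cdot>\<^bsub>K\<^esub> g \<in> hom K A E"
    by (elim kleisli_homE) (simp add: hom_iff)
next
  fix f A B assume "f \<in> hom K A B"
  then show "Idn K A \<cdot>\<^bsub>K\<^esub> f = f" "f \<cdot>\<^bsub>K\<^esub> Idn K B = f"
    by (elim kleisli_homE; simp)+
next
  fix f g h A B E F assume "f \<in> hom K A B" "g \<in> hom K B E" "h \<in> hom K E F"
  then show "(f \<cdot>\<^bsub>K\<^esub> g) \<cdot>\<^bsub>K\<^esub> h = f \<cdot>\<^bsub>K\<^esub> (g \<cdot>\<^bsub>K\<^esub> h)"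
    by (elim kleisli_homE) simp
qed

lemma branch_Inj0_Idn:
  assumes "B \<in> Obj C" "E \<in> Obj C"
    "u \<in> Arr C" "Dom C u = Prod S B B" "v \<in> Arr C" "Dom C v = Prod S B E" "Cod C v = Cod C u"
  shows "branch B E (Inj0 S B E) u v = pair C S (Idn C B) (Idn C B) \<cdot> u"
  using branch_Inj0[of B E "Idn C B" B u v] assms by simp

lemma branch_Inj1_Idn:
  assumes "B \<in> Obj C" "E \<in> Obj C"
    "u \<in> Arr C" "Dom C u = Prod S E B" "v \<in> Arr C" "Dom C v = Prod S E E" "Cod C v = Cod C u"
  shows "branch B E (Inj1 S B E) u v = pair C S (Idn C E) (Idn C E) \<cdot> v"
  using branch_Inj1[of B E "Idn C E" E u v] assms by simp

lemma kleisli_rst_Comp: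
  assumes "B \<in> Obj C" "E \<in> Obj C" "f \<in> Arr C" "Cod C f = Coprod S B (One S)" "Dom C f = A"
    "g \<in> Arr C" "Cod C g = Coprod S E (One S)" "Dom C g = A"
  shows "KR (A, f, B) \<cdot>\<^bsub>K\<^esub> (A, g, E)
    = (A, branch B (One S) f (Proj0 S A B \<cdot> g) (undef (Prod S A (One S)) E), E)"
proof -
  have A: "A \<in> Obj C" using assms by auto
  show ?thesis
    using assms A by (simp add: branch_Comp)
qed

lemma kleisli_corst_Comp:
  assumes "B \<in> Obj C" "E \<in> Obj C" "f \<in> Arr C" "Cod C f = Coprod S B (One S)" "Dom C f = A"
    "g \<in> Arr C" "Cod C g = Coprod S E (One S)" "Dom C g = A"
  shows "kleisli_corst (A, f, B) \<cdot>\<^bsub>K\<^esub> (A, g, E)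
    = (A, branch B (One S) f (undef (Prod S A B) E) (Proj0 S A (One S) \<cdot> g), E)"
proof -
  have A: "A \<in> Obj C" using assms by auto
  show ?thesis
    using assms A by (simp add: branch_Comp)
qed

text \<open>
  The law \<^emph>\<open>restriction of f, then f, is f\<close>. By naturality it suffices to treat the generic partial
  map \<open>B \<oplus> 1 \<rightarrow> B\<close>, given by the identity of \<open>B \<oplus> 1\<close>, and there the two injections decide it.
\<close>
lemma branch_partial:
  assumes "B \<in> Obj C" "f \<in> Arr C" "Cod C f = Coprod S B (One S)" "Dom C f = A"
  shows "branch B (One S) f (Proj0 S A B \<cdot> f) (undef (Prod S A (One S)) B) = f"
proof -
  let ?T = "Coprod S B (One S)"
  let ?z = "branch B (One S) (Idn C ?T) (Proj0 S ?T B) (undef (Prod S ?T (One S)) B)"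
  have A: "A \<in> Obj C" using assms by auto
  have "?z = Idn C ?T"
    by (rule copair_eqI[where A = B and B = "One S"])
       (use assms in \<open>simp_all add: Comp_branch branch_Inj0_Idn branch_Inj1_Idn\<close>)
  then have "f = f \<cdot> ?z"
    using assms by simp
  also have "\<dots> = branch B (One S) f (Proj0 S A B \<cdot> f) (undef (Prod S A (One S)) B)"
    using assms A by (simp add: Comp_branch)
  finally show ?thesis ..
qed

lemma kleisli_restriction_category: "restriction_category K KR"
proof -
  interpret K: category K by (rule kleisli_category)
  show ?thesis
  proof
    fix x A B assume x: "x \<in> hom K A B"
    then obtain f where f: "x = (A, f, B)" "A \<in> Obj C" "B \<in> Obj C" "f \<in> Arr C" "Dom C f = A"
      "Cod C f = Coprod S B (One S)" by (rule kleisli_homE)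
    show "KR x \<in> hom K A A"
      using f by (simp add: hom_iff)
    show "KR x \<cdot>\<^bsub>K\<^esub> x = x"
      using f by (simp add: kleisli_rst_Comp branch_partial del: kleisli_simps kleisli_rst_eq)
  next
    fix x y A B E assume "x \<in> hom K A B" and "y \<in> hom K A E"
    then obtain f g where f: "x = (A, f, B)" "A \<in> Obj C" "B \<in> Obj C" "f \<in> Arr C" "Dom C f = A"
      "Cod C f = Coprod S B (One S)" and g: "y = (A, g, E)" "E \<in> Obj C" "g \<in> Arr C" "Dom C g = A"
      "Cod C g = Coprod S E (One S)" by (elim kleisli_homE) auto
    show "KR x \<cdot>\<^bsub>K\<^esub> KR y = KR y \<cdot>\<^bsub>K\<^esub> KR x"
      using f g branch_commute[of B "One S" f A E "One S" g "Proj0 S A B \<cdot> Inj0 S A (One S)" "Inj1 S A (One S)"]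
      by (simp add: branch_Comp Comp_branch)
    show "KR (KR y \<cdot>\<^bsub>K\<^esub> x) = KR y \<cdot>\<^bsub>K\<^esub> KR x"
      using f g by (simp add: branch_Comp branch_branch Comp_branch branch_Inj1)
  next
    fix x y A B E assume "x \<in> hom K A B" and "y \<in> hom K B E"
    then obtain f g where f: "x = (A, f, B)" "A \<in> Obj C" "B \<in> Obj C" "f \<in> Arr C" "Dom C f = A"
      "Cod C f = Coprod S B (One S)" and g: "y = (B, g, E)" "E \<in> Obj C" "g \<in> Arr C" "Dom C g = B"
      "Cod C g = Coprod S E (One S)" by (elim kleisli_homE) auto
    let ?T = "Coprod S B (One S)" and ?g = "copair C S g (Inj1 S E (One S))"
    \<comment> \<open>By naturality in \<open>f\<close> it suffices to compare the generic cases over \<open>B \<oplus> 1\<close>.\<close>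
    have *: "branch E (One S) ?g (Proj0 S ?T E) (undef (Prod S ?T (One S)) B) =
       copair C S (branch E (One S) g (Proj0 S B E \<cdot> Inj0 S B (One S)) (undef (Prod S B (One S)) B)) (Inj1 S B (One S))"
      by (rule copair_eqI[where A = B and B = "One S"])
         (use f g in \<open>simp_all add: Comp_branch branch_Inj1_Idn\<close>)
    have "x \<cdot>\<^bsub>K\<^esub> KR y = (A, f \<cdot> branch E (One S) ?g (Proj0 S ?T E) (undef (Prod S ?T (One S)) B), B)"
      unfolding * using f g by simp
    also have "\<dots> = KR (x \<cdot>\<^bsub>K\<^esub> y) \<cdot>\<^bsub>K\<^esub> x"
      using f g by (simp add: branch_Comp Comp_branch)
    finally show "x \<cdot>\<^bsub>K\<^esub> KR y = KR (x \<cdot>\<^bsub>K\<^esub> y) \<cdot>\<^bsub>K\<^esub> x" .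
  qed
qed

lemma copair_undef [simp]:
  assumes "B \<in> Obj C" "E \<in> Obj C"
  shows "copair C S (undef B E) (Inj1 S E (One S)) = undef (Coprod S B (One S)) E"
  by (rule copair_unique[where A = B and B = "One S"]) (use assms in simp_all)

lemma kleisli_restriction_zeroes: "restriction_zeroes K KR KZ"
proof -
  interpret K: restriction_category K KR by (rule kleisli_restriction_category)
  show ?thesis
  proof
    fix A B assume "A \<in> Obj K" "B \<in> Obj K"
    then show "KZ A B \<in> hom K A B" "KR (KZ A B) = KZ A A"
      by (simp_all add: kleisli_zero_def hom_iff branch_Inj1)
  next
    fix x A B E assume "x \<in> hom K A B" "E \<in> Obj K"
    then show "x \<cdot>\<^bsub>K\<^esub> KZ B E = KZ A E"
      by (elim kleisli_homE) (simp add: kleisli_zero_def)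
  next
    fix x A B E assume "A \<in> Obj K" "x \<in> hom K B E"
    then show "KZ A B \<cdot>\<^bsub>K\<^esub> x = KZ A E"
      by (elim kleisli_homE) (simp add: kleisli_zero_def)
  qed
qed


lemma kleisli_bicart_simps [simp]:
  "One KS = One S" "Prod KS = Prod S" "Zro KS = Zro S" "Coprod KS = Coprod S"
  "\<lbrakk>A \<in> Obj C; B \<in> Obj C\<rbrakk>
    \<Longrightarrow> Proj0 KS A B = (Prod S A B, Proj0 S A B \<cdot> Inj0 S A (One S), A)"
  "\<lbrakk>A \<in> Obj C; B \<in> Obj C\<rbrakk>
    \<Longrightarrow> Proj1 KS A B = (Prod S A B, Proj1 S A B \<cdot> Inj0 S B (One S), B)"
  "\<lbrakk>A \<in> Obj C; B \<in> Obj C\<rbrakk>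
    \<Longrightarrow> Inj0 KS A B = (A, Inj0 S A B \<cdot> Inj0 S (Coprod S A B) (One S), Coprod S A B)"
  "\<lbrakk>A \<in> Obj C; B \<in> Obj C\<rbrakk>
    \<Longrightarrow> Inj1 KS A B = (B, Inj1 S A B \<cdot> Inj0 S (Coprod S A B) (One S), Coprod S A B)"
  by (simp_all add: kleisli_bicart_def kleisli_unit_def)

lemma kleisli_unit_total:
  assumes "k \<in> Arr C" "Cod C k = B" "Dom C k = A"
  shows "KR (A, k \<cdot> Inj0 S B (One S), B) = (A, Inj0 S A (One S), A)"
proof -
  have "A \<in> Obj C" "B \<in> Obj C" using assms by auto
  then show ?thesis
    using assms by (simp add: branch_Inj0)
qed

lemma kleisli_cocartesian_restriction_category: "cocartesian_restriction_category K KR KS"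
proof -
  interpret K: restriction_category K KR by (rule kleisli_restriction_category)
  show ?thesis
  proof
    show "Zro KS \<in> Obj K" by simp
  next
    fix A assume "A \<in> Obj K"
    then show "\<exists>!h. h \<in> hom K (Zro KS) A"
      by (intro ex1I[of _ "(Zro S, from_zro C S (Coprod S A (One S)), A)"])
         (auto simp: hom_iff intro: from_zro_unique[symmetric] elim!: kleisli_homE)
  next
    fix A B assume "A \<in> Obj K" "B \<in> Obj K"
    then have AB: "A \<in> Obj C" "B \<in> Obj C" by simp_all
    have ex: "\<exists>!h. h \<in> hom K (Coprod KS A B) X \<and>
      Inj0 KS A B \<cdot>\<^bsub>K\<^esub> h = x \<and> Inj1 KS A B \<cdot>\<^bsub>K\<^esub> h = y"
      if xy: "x \<in> hom K A X" "y \<in> hom K B X" for X x y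
    proof -
      obtain f g where f: "x = (A, f, X)" "X \<in> Obj C" "f \<in> Arr C" "Dom C f = A"
        "Cod C f = Coprod S X (One S)" and g: "y = (B, g, X)" "g \<in> Arr C" "Dom C g = B"
        "Cod C g = Coprod S X (One S)" using xy by (elim kleisli_homE) auto
      show ?thesis
      proof (rule ex1I[of _ "(Coprod S A B, copair C S f g, X)"])
        show "(Coprod S A B, copair C S f g, X) \<in> hom K (Coprod KS A B) X \<and>
          Inj0 KS A B \<cdot>\<^bsub>K\<^esub> (Coprod S A B, copair C S f g, X) = x \<and>
          Inj1 KS A B \<cdot>\<^bsub>K\<^esub> (Coprod S A B, copair C S f g, X) = y"
          using AB f g by (simp add: hom_iff)
      next
        fix z assume z: "z \<in> hom K (Coprod KS A B) X \<and>
          Inj0 KS A B \<cdot>\<^bsub>K\<^esub> z = x \<and> Inj1 KS A B \<cdot>\<^bsub>K\<^esub> z = y"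
        then obtain h where h: "z = (Coprod S A B, h, X)" "h \<in> Arr C" "Dom C h = Coprod S A B"
          "Cod C h = Coprod S X (One S)" by (auto elim: kleisli_homE)
        have "copair C S f g = h"
          by (rule copair_unique[where A = A and B = B]) (use z h f g AB in simp_all)
        then show "z = (Coprod S A B, copair C S f g, X)"
          using h by simp
      qed
    qed
    show "is_coproduct K A B (Coprod KS A B) (Inj0 KS A B) (Inj1 KS A B)"
      unfolding is_coproduct_def
      by (intro conjI ballI ex) (use AB in \<open>simp_all add: hom_iff\<close>)
    show "is_total K KR (Inj0 KS A B)" "is_total K KR (Inj1 KS A B)"
      using AB by (simp_all add: is_total_def kleisli_unit_total del: kleisli_rst_eq)
  qed
qed

text \<open>
  Totality of \<open>t\<close> says that a case analysis of \<open>t\<close> equals \<open>\<iota>\<^sub>0\<close>; composed with \<open>[!\<iota>\<^sub>0, \<iota>\<^sub>1]\<close> the analysis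
  becomes \<open>t\<close> again, because maps into \<open>1\<close> are unique.
\<close>
lemma total_to_One:
  assumes "x \<in> hom K A (One S)" "is_total K KR x"
  shows "x = (A, to_one C S A \<cdot> Inj0 S (One S) (One S), One S)"
proof -
  obtain t where t: "x = (A, t, One S)" "A \<in> Obj C" "t \<in> Arr C" "Dom C t = A"
    "Cod C t = Coprod S (One S) (One S)" using assms by (auto elim: kleisli_homE)
  let ?c = "copair C S (to_one C S A \<cdot> Inj0 S (One S) (One S)) (Inj1 S (One S) (One S))"
  have "Inj0 S A (One S) = branch (One S) (One S) t (Proj0 S A (One S) \<cdot> Inj0 S A (One S))
      (undef (Prod S A (One S)) A)"
    using t assms(2) by (simp add: is_total_def)
  then have "Inj0 S A (One S) \<cdot> ?c = branch (One S) (One S) t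
      (Proj0 S A (One S) \<cdot> Inj0 S A (One S)) (undef (Prod S A (One S)) A) \<cdot> ?c"
    by simp
  also have "\<dots> = t"
    using branch_eta[of "One S" "One S" t A] t by (simp add: branch_Comp Proj1_One)
  finally show ?thesis
    using t by simp
qed

text \<open>
  The map \<open>X \<rightarrow> A \<times> B \<oplus> 1\<close> defined exactly where both \<open>f : X \<rightarrow> A \<oplus> 1\<close> and \<open>g : X \<rightarrow> B \<oplus> 1\<close> are.
\<close>
definition strict_pair :: "'a \<Rightarrow> 'a \<Rightarrow> 'b \<Rightarrow> 'b \<Rightarrow> 'b" where
  "strict_pair A B f g = branch A (One S) f
    (branch B (One S) (Proj0 S (Dom C f) A \<cdot> g)
      (pair C S (Proj0 S (Prod S (Dom C f) A) B \<cdot> Proj1 S (Dom C f) A) (Proj1 S (Prod S (Dom C f) A) B)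
        \<cdot> Inj0 S (Prod S A B) (One S))
      (undef (Prod S (Prod S (Dom C f) A) (One S)) (Prod S A B)))
    (undef (Prod S (Dom C f) (One S)) (Prod S A B))"

lemma strict_pair_Arr [simp]:
  assumes "A \<in> Obj C" "B \<in> Obj C" "f \<in> Arr C" "Cod C f = Coprod S A (One S)"
    "g \<in> Arr C" "Cod C g = Coprod S B (One S)" "Dom C g = Dom C f"
  shows "strict_pair A B f g \<in> Arr C" "Dom C (strict_pair A B f g) = Dom C f"
    "Cod C (strict_pair A B f g) = Coprod S (Prod S A B) (One S)"
  using assms by (simp_all add: strict_pair_def)

lemma Comp_strict_pair:
  assumes "A \<in> Obj C" "B \<in> Obj C" "f \<in> Arr C" "Cod C f = Coprod S A (One S)" "Dom C f = X"
    "g \<in> Arr C" "Cod C g = Coprod S B (One S)" "Dom C g = X" "k \<in> Arr C" "Cod C k = X"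
  shows "k \<cdot> strict_pair A B f g = strict_pair A B (k \<cdot> f) (k \<cdot> g)"
proof -
  obtain Y where Y: "Dom C k = Y" "Y \<in> Obj C" "X \<in> Obj C" using assms by auto
  show ?thesis
    using assms Y by (simp add: strict_pair_def Comp_branch)
qed

text \<open>
  Uniqueness of the pairing of partial maps: strict pairing is a retraction of
  \<open>A \<times> B \<oplus> 1 \<rightarrow> (A \<oplus> 1) \<times> (B \<oplus> 1)\<close>, so a partial map into \<open>A \<times> B\<close> can be recovered from its two
  projections. It suffices to check this for the identity of \<open>A \<times> B \<oplus> 1\<close>.
\<close>
lemma strict_pair_projections:
  assumes "A \<in> Obj C" "B \<in> Obj C" "h \<in> Arr C" "Cod C h = Coprod S (Prod S A B) (One S)"
  shows "strict_pair A B
      (h \<cdot> copair C S (Proj0 S A B \<cdot> Inj0 S A (One S)) (Inj1 S A (One S)))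
      (h \<cdot> copair C S (Proj1 S A B \<cdot> Inj0 S B (One S)) (Inj1 S B (One S))) = h"
proof -
  let ?p = "copair C S (Proj0 S A B \<cdot> Inj0 S A (One S)) (Inj1 S A (One S))"
  let ?q = "copair C S (Proj1 S A B \<cdot> Inj0 S B (One S)) (Inj1 S B (One S))"
  have "strict_pair A B ?p ?q = Idn C (Coprod S (Prod S A B) (One S))"
  proof (rule copair_eqI[where A = "Prod S A B" and B = "One S"])
    show "Inj0 S (Prod S A B) (One S) \<cdot> strict_pair A B ?p ?q
        = Inj0 S (Prod S A B) (One S) \<cdot> Idn C (Coprod S (Prod S A B) (One S))"
      using assms(1,2)
      by (simp add: Comp_strict_pair[where X = "Coprod S (Prod S A B) (One S)"])
         (simp add: strict_pair_def branch_Inj0 Comp_branch)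
    show "Inj1 S (Prod S A B) (One S) \<cdot> strict_pair A B ?p ?q
        = Inj1 S (Prod S A B) (One S) \<cdot> Idn C (Coprod S (Prod S A B) (One S))"
      using assms(1,2)
      by (simp add: Comp_strict_pair[where X = "Coprod S (Prod S A B) (One S)"])
         (simp add: strict_pair_def branch_Inj1_Idn)
  qed (use assms in simp_all)
  then have "h = h \<cdot> strict_pair A B ?p ?q"
    using assms by simp
  also have "\<dots> = strict_pair A B (h \<cdot> ?p) (h \<cdot> ?q)"
    by (rule Comp_strict_pair[where X = "Coprod S (Prod S A B) (One S)"]) (use assms in simp_all)
  finally show ?thesis ..
qed

lemma kleisli_cartesian_restriction_category: "cartesian_restriction_category K KR KS"
proof -
  interpret K: restriction_category K KR by (rule kleisli_restriction_category)
  show ?thesis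
  proof
    show "One KS \<in> Obj K" by simp
  next
    fix A assume "A \<in> Obj K"
    then show "\<exists>!t. t \<in> hom K A (One KS) \<and> is_total K KR t"
      by (intro ex1I[of _ "(A, to_one C S A \<cdot> Inj0 S (One S) (One S), One S)"])
         (auto simp: hom_iff is_total_def kleisli_unit_total total_to_One simp del: kleisli_rst_eq)
  next
    fix x A B s t assume "x \<in> hom K A B" and "s \<in> hom K B (One KS)" "is_total K KR s"
      "t \<in> hom K A (One KS)" "is_total K KR t"
    then obtain f where f: "x = (A, f, B)" "A \<in> Obj C" "B \<in> Obj C" "f \<in> Arr C" "Dom C f = A"
      "Cod C f = Coprod S B (One S)" and
      st: "s = (B, to_one C S B \<cdot> Inj0 S (One S) (One S), One S)"
       "t = (A, to_one C S A \<cdot> Inj0 S (One S) (One S), One S)"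
      by (auto elim: kleisli_homE simp: total_to_One)
    let ?c = "copair C S (to_one C S B \<cdot> Inj0 S (One S) (One S)) (Inj1 S (One S) (One S))"
    have "f \<cdot> ?c = branch B (One S) f (Proj1 S A B \<cdot> Inj0 S B (One S))
        (Proj1 S A (One S) \<cdot> Inj1 S B (One S)) \<cdot> ?c"
      using f by (simp add: branch_eta)
    then show "x \<cdot>\<^bsub>K\<^esub> s = KR x \<cdot>\<^bsub>K\<^esub> t"
      using f st by (simp add: branch_Comp Proj1_One)
  next
    fix A B assume "A \<in> Obj K" "B \<in> Obj K"
    then have AB: "A \<in> Obj C" "B \<in> Obj C" by simp_all
    have ex: "\<exists>!h. h \<in> hom K X (Prod KS A B) \<and>
      h \<cdot>\<^bsub>K\<^esub> Proj0 KS A B = KR y \<cdot>\<^bsub>K\<^esub> x \<and> h \<cdot>\<^bsub>K\<^esub> Proj1 KS A B = KR x \<cdot>\<^bsub>K\<^esub> y"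
      if xy: "x \<in> hom K X A" "y \<in> hom K X B" for X x y
    proof -
      obtain f g where f: "x = (X, f, A)" "X \<in> Obj C" "f \<in> Arr C" "Dom C f = X"
        "Cod C f = Coprod S A (One S)" and g: "y = (X, g, B)" "g \<in> Arr C" "Dom C g = X"
        "Cod C g = Coprod S B (One S)" using xy by (elim kleisli_homE) auto
      let ?h = "strict_pair A B f g"
      \<comment> \<open>The strict pairing tests \<open>f\<close> first, but its first projection should be \<open>f\<close> guarded by \<open>g\<close>:
        the two tests have to be interchanged.\<close>
      have 1: "(X, ?h, Prod S A B) \<cdot>\<^bsub>K\<^esub> Proj0 KS A B = KR y \<cdot>\<^bsub>K\<^esub> x"
      proof -
        have "branch B (One S) g (Proj0 S X B \<cdot> f) (undef (Prod S X (One S)) A)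
          = branch B (One S) g (Proj0 S X B \<cdot> branch A (One S) f (Proj1 S X A \<cdot> Inj0 S A (One S))
              (undef (Prod S X (One S)) A)) (undef (Prod S X (One S)) A)"
          using branch_eta[of A "One S" f X] f AB by (simp add: Proj1_One)
        also have "\<dots> = branch A (One S) f (branch B (One S) (Proj0 S X A \<cdot> g)
             (Proj0 S (Prod S X A) B \<cdot> (Proj1 S X A \<cdot> Inj0 S A (One S)))
             (undef (Prod S (Prod S X A) (One S)) A)) (undef (Prod S X (One S)) A)"
          by (rule branch_commute) (use f g AB in simp_all)
        finally show ?thesis
          using f g AB by (simp add: strict_pair_def branch_Comp)
      qed
      have 2: "(X, ?h, Prod S A B) \<cdot>\<^bsub>K\<^esub> Proj1 KS A B = KR x \<cdot>\<^bsub>K\<^esub> y"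
      proof -
        have "branch B (One S) (Proj0 S X A \<cdot> g)
             (Proj1 S (Prod S X A) B \<cdot> Inj0 S B (One S))
             (undef (Prod S (Prod S X A) (One S)) B) = Proj0 S X A \<cdot> g"
          using branch_eta[of B "One S" "Proj0 S X A \<cdot> g" "Prod S X A"] f g AB
          by (simp add: Proj1_One)
        then show ?thesis
          using f g AB by (simp add: strict_pair_def branch_Comp)
      qed
      show ?thesis
      proof (rule ex1I[of _ "(X, ?h, Prod S A B)"])
        show "(X, ?h, Prod S A B) \<in> hom K X (Prod KS A B) \<and>
          (X, ?h, Prod S A B) \<cdot>\<^bsub>K\<^esub> Proj0 KS A B = KR y \<cdot>\<^bsub>K\<^esub> x \<and>
          (X, ?h, Prod S A B) \<cdot>\<^bsub>K\<^esub> Proj1 KS A B = KR x \<cdot>\<^bsub>K\<^esub> y"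
          using 1 2 f g AB by (simp add: hom_iff del: kleisli_rst_eq)
      next
        fix z assume z: "z \<in> hom K X (Prod KS A B) \<and>
          z \<cdot>\<^bsub>K\<^esub> Proj0 KS A B = KR y \<cdot>\<^bsub>K\<^esub> x \<and> z \<cdot>\<^bsub>K\<^esub> Proj1 KS A B = KR x \<cdot>\<^bsub>K\<^esub> y"
        then obtain h where h: "z = (X, h, Prod S A B)" "h \<in> Arr C" "Dom C h = X"
          "Cod C h = Coprod S (Prod S A B) (One S)" by (auto elim: kleisli_homE)
        have "z \<cdot>\<^bsub>K\<^esub> Proj0 KS A B = (X, ?h, Prod S A B) \<cdot>\<^bsub>K\<^esub> Proj0 KS A B"
          "z \<cdot>\<^bsub>K\<^esub> Proj1 KS A B = (X, ?h, Prod S A B) \<cdot>\<^bsub>K\<^esub> Proj1 KS A B"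
          using z 1 2 by metis+
        then have "h \<cdot> copair C S (Proj0 S A B \<cdot> Inj0 S A (One S)) (Inj1 S A (One S))
            = ?h \<cdot> copair C S (Proj0 S A B \<cdot> Inj0 S A (One S)) (Inj1 S A (One S))"
          "h \<cdot> copair C S (Proj1 S A B \<cdot> Inj0 S B (One S)) (Inj1 S B (One S))
            = ?h \<cdot> copair C S (Proj1 S A B \<cdot> Inj0 S B (One S)) (Inj1 S B (One S))"
          using AB h(1) by simp_all
        moreover have "?h \<in> Arr C" "Cod C ?h = Coprod S (Prod S A B) (One S)"
          using AB f g by simp_all
        ultimately have "h = ?h"
          using strict_pair_projections[OF AB, of h] strict_pair_projections[OF AB, of ?h] h(2,4)
          by metis
        then show "z = (X, ?h, Prod S A B)"
          using h(1) by simp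
      qed
    qed
    show "is_restriction_product K KR A B (Prod KS A B) (Proj0 KS A B) (Proj1 KS A B)"
      unfolding is_restriction_product_def
      by (intro conjI ballI ex)
         (use AB in \<open>simp_all add: is_total_def hom_iff kleisli_unit_total del: kleisli_rst_eq\<close>)
  qed
qed


text \<open>
  The distributivity maps of the Kleisli category are the images of those of the base category under
  the functor \<open>kleisli_unit\<close>, which preserves composition, pairings and copairings, and hence
  isomorphisms.
\<close>
lemma kleisli_unit_Comp:
  assumes "f \<in> Arr C" "g \<in> Arr C" "Cod C f = Dom C g"
  shows "kleisli_unit C S f \<cdot>\<^bsub>K\<^esub> kleisli_unit C S g = kleisli_unit C S (f \<cdot> g)"
  using assms by (simp add: kleisli_unit_def)

lemma kleisli_unit_iso:
  assumes "is_iso C f"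
  shows "is_iso K (kleisli_unit C S f)"
proof -
  obtain g where "is_inverse C f g"
    using assms by (auto simp: is_iso_def)
  then have "f \<in> Arr C" "g \<in> Arr C" "Dom C g = Cod C f" "Cod C g = Dom C f"
    "f \<cdot> g = Idn C (Dom C f)" "g \<cdot> f = Idn C (Cod C f)"
    by (auto simp: is_inverse_def hom_iff)
  then have "is_inverse K (kleisli_unit C S f) (kleisli_unit C S g)"
    unfolding is_inverse_def
    by (simp add: kleisli_unit_Comp) (simp add: kleisli_unit_def hom_iff)
  then show ?thesis
    unfolding is_iso_def by (rule exI)
qed

lemma kleisli_unit_copair:
  assumes "f \<in> Arr C" "g \<in> Arr C" "Cod C g = Cod C f"
  shows "copair K KS (kleisli_unit C S f) (kleisli_unit C S g) = kleisli_unit C S (copair C S f g)"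
proof -
  interpret K: cocartesian_restriction_category K KR KS
    by (rule kleisli_cocartesian_restriction_category)
  show ?thesis
    by (rule K.copair_unique[where A = "Dom C f" and B = "Dom C g"])
       (use assms in \<open>simp_all add: kleisli_unit_def\<close>)
qed

lemma kleisli_unit_pair:
  assumes "f \<in> Arr C" "g \<in> Arr C" "Dom C g = Dom C f"
  shows "rpair K KR KS (kleisli_unit C S f) (kleisli_unit C S g) = kleisli_unit C S (pair C S f g)"
proof -
  interpret K: cartesian_restriction_category K KR KS
    by (rule kleisli_cartesian_restriction_category)
  let ?x = "kleisli_unit C S f" and ?y = "kleisli_unit C S g"
  have "?x \<in> hom K (Dom C f) (Cod C f)" "?y \<in> hom K (Dom C f) (Cod C g)"
    using assms by (simp_all add: hom_iff kleisli_unit_def)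
  then have ex: "\<exists>!h. h \<in> hom K (Dom C f) (Prod KS (Cod C f) (Cod C g)) \<and>
     h \<cdot>\<^bsub>K\<^esub> Proj0 KS (Cod C f) (Cod C g) = KR ?y \<cdot>\<^bsub>K\<^esub> ?x \<and>
     h \<cdot>\<^bsub>K\<^esub> Proj1 KS (Cod C f) (Cod C g) = KR ?x \<cdot>\<^bsub>K\<^esub> ?y"
    using K.Prod_restriction_product[of "Cod C f" "Cod C g"] assms
    by (simp add: is_restriction_product_def del: kleisli_bicart_simps(2,5-))
  have "kleisli_unit C S (pair C S f g) \<in> hom K (Dom C f) (Prod KS (Cod C f) (Cod C g))"
    "kleisli_unit C S (pair C S f g) \<cdot>\<^bsub>K\<^esub> Proj0 KS (Cod C f) (Cod C g) = KR ?y \<cdot>\<^bsub>K\<^esub> ?x"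
    "kleisli_unit C S (pair C S f g) \<cdot>\<^bsub>K\<^esub> Proj1 KS (Cod C f) (Cod C g) = KR ?x \<cdot>\<^bsub>K\<^esub> ?y"
    using assms by (simp_all add: kleisli_unit_def hom_iff kleisli_unit_total del: kleisli_rst_eq)
  moreover have types: "Dom K ?x = Dom C f" "Cod K ?x = Cod C f" "Cod K ?y = Cod C g"
    by (simp_all add: kleisli_unit_def)
  ultimately show ?thesis
    unfolding rpair_def types by (intro the1_equality[OF ex] conjI)
qed

lemma kleisli_distributive_restriction_category: "distributive_restriction_category K KR KS"
proof -
  interpret K: cartesian_restriction_category K KR KS
    by (rule kleisli_cartesian_restriction_category)
  interpret K: cocartesian_restriction_category K KR KS
    by (rule kleisli_cocartesian_restriction_category)
  show ?thesis
  proof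
    fix A B E assume "A \<in> Obj K" "B \<in> Obj K" "E \<in> Obj K"
    then have obj: "A \<in> Obj C" "B \<in> Obj C" "E \<in> Obj C" by simp_all
    have "distr K KS (rpair K KR KS) A B E = kleisli_unit C S (distr C S (pair C S) A B E)"
      using obj unfolding distr_def id_times_def
      by (simp add: kleisli_bicart_def kleisli_unit_Comp kleisli_unit_pair[unfolded kleisli_bicart_def]
           kleisli_unit_copair[unfolded kleisli_bicart_def] del: kleisli_bicart_simps)
    then show "is_iso K (distr K KS (rpair K KR KS) A B E)"
      using obj by (simp add: kleisli_unit_iso distr_iso)
  next
    fix A assume "A \<in> Obj K"
    then have A: "A \<in> Obj C" by simp
    have "from_zro K KS A = kleisli_unit C S (from_zro C S A)"
      by (rule K.from_zro_unique) (use A in \<open>simp_all add: kleisli_unit_def\<close>)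
    moreover have "Idn K (Zro KS) = kleisli_unit C S (Idn C (Zro S))"
      by (simp add: kleisli_unit_def)
    ultimately have "distr0 K KS (rpair K KR KS) A = kleisli_unit C S (distr0 C S (pair C S) A)"
      using A unfolding distr0_def by (simp add: kleisli_unit_pair)
    then show "is_iso K (distr0 K KS (rpair K KR KS) A)"
      using A by (simp add: kleisli_unit_iso distr0_iso)
  qed
qed


lemma kleisli_complemented_restriction_category:
  "complemented_restriction_category K KR KZ kleisli_corst"
proof -
  interpret K: restriction_zeroes K KR KZ by (rule kleisli_restriction_zeroes)
  show ?thesis
  proof
    fix x A B assume "x \<in> hom K A B"
    then obtain f where f: "x = (A, f, B)" "A \<in> Obj C" "B \<in> Obj C" "f \<in> Arr C" "Dom C f = A"
      "Cod C f = Coprod S B (One S)" by (rule kleisli_homE)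
    show "kleisli_corst x \<in> hom K A A"
      using f by (simp add: hom_iff)
    show "KR (kleisli_corst x) = kleisli_corst x"
      using f by (simp add: branch_branch branch_Inj0 branch_Inj1 Comp_branch)
    show "KR x \<cdot>\<^bsub>K\<^esub> kleisli_corst x = KZ A A"
      using f by (simp add: branch_Comp branch_same0 branch_const_to_one kleisli_zero_def)
  next
    fix x y A B E assume "x \<in> hom K A B" and "y \<in> hom K B E"
    then obtain f g where f: "x = (A, f, B)" "A \<in> Obj C" "B \<in> Obj C" "f \<in> Arr C" "Dom C f = A"
      "Cod C f = Coprod S B (One S)" and g: "y = (B, g, E)" "E \<in> Obj C" "g \<in> Arr C" "Dom C g = B"
      "Cod C g = Coprod S E (One S)" by (elim kleisli_homE) auto
    let ?T = "Coprod S B (One S)" and ?g = "copair C S g (Inj1 S E (One S))"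
    \<comment> \<open>As for restrictions: the generic cases over \<open>B \<oplus> 1\<close> suffice.\<close>
    have *: "branch E (One S) ?g (undef (Prod S ?T E) B) (Proj0 S ?T (One S)) =
       copair C S (branch E (One S) g (undef (Prod S B E) B) (Proj0 S B (One S) \<cdot> Inj0 S B (One S)))
         (Inj1 S B (One S))"
      by (rule copair_eqI[where A = B and B = "One S"])
         (use f g in \<open>simp_all add: Comp_branch branch_Inj1_Idn\<close>)
    have "x \<cdot>\<^bsub>K\<^esub> kleisli_corst y
        = (A, f \<cdot> branch E (One S) ?g (undef (Prod S ?T E) B) (Proj0 S ?T (One S)), B)"
      unfolding * using f g by simp
    also have "\<dots> = kleisli_corst (x \<cdot>\<^bsub>K\<^esub> y) \<cdot>\<^bsub>K\<^esub> x"
      using f g by (simp add: branch_Comp Comp_branch)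
    finally show "x \<cdot>\<^bsub>K\<^esub> kleisli_corst y = kleisli_corst (x \<cdot>\<^bsub>K\<^esub> y) \<cdot>\<^bsub>K\<^esub> x" .
  next
    fix x y z A B E assume "x \<in> hom K A B" and "y \<in> hom K A E" and "z \<in> hom K A E"
    then obtain f h k where f: "x = (A, f, B)" "A \<in> Obj C" "B \<in> Obj C" "f \<in> Arr C" "Dom C f = A"
      "Cod C f = Coprod S B (One S)" and h: "y = (A, h, E)" "E \<in> Obj C" "h \<in> Arr C" "Dom C h = A"
      "Cod C h = Coprod S E (One S)" and k: "z = (A, k, E)" "k \<in> Arr C" "Dom C k = A"
      "Cod C k = Coprod S E (One S)" by (elim kleisli_homE) auto
    let ?m = "branch B (One S) f (Proj0 S A B \<cdot> h) (Proj0 S A (One S) \<cdot> k)"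
    have "KR x \<cdot>\<^bsub>K\<^esub> (A, ?m, E) = KR x \<cdot>\<^bsub>K\<^esub> y" "kleisli_corst x \<cdot>\<^bsub>K\<^esub> (A, ?m, E) = kleisli_corst x \<cdot>\<^bsub>K\<^esub> z"
      using f h k by (simp_all add: kleisli_rst_Comp kleisli_corst_Comp branch_same0 branch_same1
          del: kleisli_simps(6) kleisli_rst_eq kleisli_corst_eq)
    moreover have "(A, ?m, E) \<in> hom K A E"
      using f h k by (simp add: hom_iff)
    ultimately show "\<exists>m \<in> hom K A E. KR x \<cdot>\<^bsub>K\<^esub> m = KR x \<cdot>\<^bsub>K\<^esub> y
        \<and> kleisli_corst x \<cdot>\<^bsub>K\<^esub> m = kleisli_corst x \<cdot>\<^bsub>K\<^esub> z"
      by blast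
    assume eq: "KR x \<cdot>\<^bsub>K\<^esub> y = KR x \<cdot>\<^bsub>K\<^esub> z" "kleisli_corst x \<cdot>\<^bsub>K\<^esub> y = kleisli_corst x \<cdot>\<^bsub>K\<^esub> z"
    let ?R = "\<lambda>h. branch B (One S) f (Proj0 S A B \<cdot> h) (undef (Prod S A (One S)) E)"
    let ?N = "\<lambda>h. branch B (One S) f (undef (Prod S A B) E) (Proj0 S A (One S) \<cdot> h)"
    have "?R h = ?R k" "?N h = ?N k"
      using eq f h k by (simp_all add: kleisli_rst_Comp kleisli_corst_Comp
          del: kleisli_simps(6) kleisli_rst_eq kleisli_corst_eq)
    \<comment> \<open>Any \<open>l\<close> is put together again from its two guarded parts.\<close>
    moreover have "branch B (One S) f (Proj0 S A B \<cdot> ?R l) (Proj0 S A (One S) \<cdot> ?N l) = l"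
      if "l \<in> Arr C" "Dom C l = A" "Cod C l = Coprod S E (One S)" for l
      using f h(2) that by (simp add: branch_same0 branch_same1 branch_const)
    ultimately show "y = z"
      using h k by metis
  qed
qed

end

section \<open>The classical structure of the Kleisli category\<close>

theorem proposition7p4:
  fixes D :: "('o, 'm) cat" and S :: "('o, 'm) bicart"
  assumes "distributive_category D S"
  shows "restriction_zeroes (kleisli D S) (kleisli_rst D S) (kleisli_zero D S) \<and>
         has_classical_products (kleisli D S) (kleisli_rst D S) (kleisli_bicart D S) \<and>
         classical_distributive_restriction_category
           (kleisli D S) (kleisli_rst D S) (kleisli_bicart D S)"
proof -
  note complemented = distributive_category.kleisli_complemented_restriction_category[OF assms]
  note distributive = distributive_category.kleisli_distributive_restriction_category[OF assms]
  have "classical_distributive_restriction_category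
      (kleisli D S) (kleisli_rst D S) (kleisli_bicart D S)"
    using complemented_restriction_category.classical[OF complemented] distributive
    by (simp add: classical_distributive_restriction_category_def)
  moreover have "has_classical_products (kleisli D S) (kleisli_rst D S) (kleisli_bicart D S)"
    using complemented distributive
    by (intro complemented_distributive_restriction_category.classical_products
        complemented_distributive_restriction_category.intro)
  moreover have "restriction_zeroes (kleisli D S) (kleisli_rst D S) (kleisli_zero D S)"
    by (rule distributive_category.kleisli_restriction_zeroes[OF assms])
  ultimately show ?thesis by blast
qed

end
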